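(* Let $\mathcal{R}$ be right amenable, let $\mathcal{F}$ be a right Følner net in $\mathcal{R}$, let $M$ be infinite, let $X$ be a strongly irreducible subshift of $Q^M$ of finite type, let $Y$ be a subshift of $Q^M$, and let $\Delta$ be a local map from $X$ to $Y$ that is not pre-injective. Then $\mathrm{ent}_{\mathcal{F}}(\Delta(X)) < \mathrm{ent}_{\mathcal{F}}(X)$.
   Context: Setting. A group $G$ acts transitively from the left on a non-empty set $M$; the action is written $(g,m)\mapsto g\triangleright m$. An element $m_0\in M$ and, for each $m\in M$, an element $g_{m_0,m}\in G$ with $g_{m_0,m}\triangleright m_0=m$ are fixed; $\mathcal{R}=((M,G,\triangleright),(m_0,(g_{m_0,m})_{m\in M}))$ is called a cell space. The stabiliser $G_0$ of $m_0$ is finite. The right semi-action of $G/G_0$ on $M$ is $m\triangleleft gG_0=g_{m_0,m}g\triangleright m_0$. Identify $M$ with $G/G_0$ via $m\mapsto\{g\in G: g\triangleright m_0=m\}$; then $m\triangleleft n=g_{m_0,m}\triangleright n$ for $m,n\in M$. For $A\subseteq M$, $A\triangleleft\mathfrak{g}=\{a\triangleleft\mathfrak{g}: a\in A\}$. $\mathcal{R}$ is finitely right generated, and $S$ is a fixed finite symmetric right generating set: a finite $S\subseteq G/G_0$ with $G_0\cdot S\subseteq S$ and $S^{-1}:=\{g^{-1}G_0: s\in S,\ g\in s\}\subseteq S$ such that each $m\in M$ has the form $(((m_0\triangleleft s_1)\triangleleft s_2)\cdots)\triangleleft s_k$ with $k\ge 0$, $s_i\in S$. $d$ is the path metric on $M$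 of the graph with an edge from $m$ to $m\triangleleft s$ for $m\in M$, $s\in S$. $\mathbb{B}(m,\rho)=\{m'\in M: d(m,m')\le\rho\}$ and $\mathbb{B}(\rho)=\mathbb{B}(m_0,\rho)$ for $\rho\in\mathbb{N}_0$. For $A,B\subseteq M$, $d(A,B)=\inf\{d(a,b): a\in A, b\in B\}$ (with $\inf\emptyset=\infty$). For $A\subseteq M$ and $\theta\in\mathbb{N}_0$: $A^{-\theta}=\{m\in A:\mathbb{B}(m,\theta)\subseteq A\}$, $A^{+\theta}=\{m\in M:\mathbb{B}(m,\theta)\cap A\neq\emptyset\}$, $\partial_\theta A=A^{+\theta}\setminus A^{-\theta}$. $H$ is a fixed subgroup of $G$ containing all $g_{m_0,m}$, $m\in M$; $H_0=H\cap G_0$. $Q$ is a finite set. Patterns and subshifts. For $A\subseteq M$, an $A$-pattern is a map $p\colon A\to Q$, with domain $\mathrm{dom}(p)=A$; it is finite if $A$ is finite. For $g\in G$, $g\blacktriangleright p\colon g\triangleright A\to Q$, $m\mapsto p(g^{-1}\triangleright m)$. An $A$-pattern $p$ semi-occurs in an $A'$-pattern $p'$ if there is $h\in H$ with $h\triangleright A\subseteq A'$ and $h\blacktriangleright p=p'|_{h\triangleright A}$. For a set $\mathfrak{F}$ of finite patterns, $\langle\mathfrak{F}\rangle$ is the set of $c\in Q^M$ in which no $\mathfrak{f}\in\mathfrak{F}$ semi-occurs. A subset $X\subseteq Q^M$ is a subshift of $Q^M$ if $X=\langle\mathfrak{F}\rangle$ for some set $\mathfrak{F}$ of finite patterns;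 it is of finite type if $\mathfrak{F}$ can be chosen finite. A pattern is allowed in $X$ if it semi-occurs in some $x\in X$. For $X\subseteq Q^M$ and $A\subseteq M$, $X_A=\{x|_A: x\in X\}$. A subshift $X$ is $\kappa$-strongly irreducible ($\kappa\in\mathbb{N}_0$) if for all finite patterns $p,p'$ allowed in $X$ with $d(\mathrm{dom}(p),\mathrm{dom}(p'))\ge\kappa+1$ there is $x\in X$ with $x|_{\mathrm{dom}(p)}=p$ and $x|_{\mathrm{dom}(p')}=p'$; it is strongly irreducible if it is so for some $\kappa$. Local maps. For subshifts $X,Y$, a map $\Delta\colon X\to Y$ is $\kappa$-local if there are $N\subseteq\mathbb{B}(\kappa)$ with $G_0\triangleright N\subseteq N$ and $\delta\colon X_N\to Q$ with $\delta(h_0\blacktriangleright\ell)=\delta(\ell)$ for all $h_0\in H_0$, $\ell\in X_N$, such that $\Delta(x)(m)=\delta(n\mapsto x(m\triangleleft n))$ for all $x\in X$, $m\in M$; it is local if it is $\kappa$-local for some $\kappa\in\mathbb{N}_0$. $\Delta$ is pre-injective if for all $x,x'\in X$ such that $\{m: x(m)\ne x'(m)\}$ is finite and $\Delta(x)=\Delta(x')$, one has $x=x'$. Amenability and entropy. $\mathcal{R}$ is right amenable if there is a finitely additive probability measure $\mu$ on all subsets of $M$ such that $\mu(A\triangleleft\mathfrak{g})=\mu(A)$ for all $\mathfrak{g}\in G/G_0$ and all $A\subseteq M$ on which $m\mapsto m\triangleleft\mathfrak{g}$ is injective; since $G_0$ is finite, this is equivalent to the existence of a right Følner net, i.e. a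 net $(F_i)_{i\in I}$ of non-empty finite subsets of $M$ with $\lim_{i\in I}|\partial_\rho F_i|/|F_i|=0$ for every $\rho\in\mathbb{N}_0$. For such a net $\mathcal{F}$ and $X\subseteq Q^M$, the entropy is $\mathrm{ent}_{\mathcal{F}}(X)=\limsup_{i\in I}\log|X_{F_i}|/|F_i|$ (with $\log 0=-\infty$). *)

theory Defs
  imports
    "HOL-Algebra.Group_Action"
    "HOL-Algebra.Left_Coset"
    "HOL-Library.Extended_Real"
    "HOL-Library.Liminf_Limsup"
    "HOL-Library.FuncSet"
begin

text \<open>The non-empty set \<open>M\<close> is the universe of the type \<open>'m\<close>; \<open>coord \<R> m\<close> is the element
  \<open>g\<^sub>m\<^sub>0\<^sub>,\<^sub>m\<close>.\<close>

record ('g, 'm) cell_space =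
  grp :: "'g monoid"
  act :: "'g \<Rightarrow> 'm \<Rightarrow> 'm"
  orig :: 'm
  coord :: "'m \<Rightarrow> 'g"

definition is_cell_space :: "('g, 'm) cell_space \<Rightarrow> bool" where
  "is_cell_space \<R> \<longleftrightarrow>
     transitive_action (grp \<R>) UNIV (act \<R>) \<and>
     (\<forall>m. coord \<R> m \<in> carrier (grp \<R>) \<and> act \<R> (coord \<R> m) (orig \<R>) = m)"

definition stab :: "('g, 'm) cell_space \<Rightarrow> 'g set" where
  "stab \<R> = stabilizer (grp \<R>) (act \<R>) (orig \<R>)"

definition cosets :: "('g, 'm) cell_space \<Rightarrow> 'g set set" where
  "cosets \<R> = lcosets\<^bsub>grp \<R>\<^esub> (stab \<R>)"

text \<open>The right semi-action of a coset \<open>\<gg>\<close>; the image below is a singleton, since the value does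
  not depend on the representative \<open>g\<close>.\<close>

definition semi_act :: "('g, 'm) cell_space \<Rightarrow> 'm \<Rightarrow> 'g set \<Rightarrow> 'm" where
  "semi_act \<R> m \<gg> =
     the_elem ((\<lambda>g. act \<R> (coord \<R> m \<otimes>\<^bsub>grp \<R>\<^esub> g) (orig \<R>)) ` \<gg>)"

definition coset_of :: "('g, 'm) cell_space \<Rightarrow> 'm \<Rightarrow> 'g set" where
  "coset_of \<R> m = {g \<in> carrier (grp \<R>). act \<R> g (orig \<R>) = m}"

definition semi_act_pt :: "('g, 'm) cell_space \<Rightarrow> 'm \<Rightarrow> 'm \<Rightarrow> 'm" where
  "semi_act_pt \<R> m n = semi_act \<R> m (coset_of \<R> n)"

definition sym_right_generating :: "('g, 'm) cell_space \<Rightarrow> 'g set set \<Rightarrow> bool" where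
  "sym_right_generating \<R> S \<longleftrightarrow>
     S \<subseteq> cosets \<R> \<and>
     (\<forall>g\<^sub>0 \<in> stab \<R>. \<forall>s \<in> S. g\<^sub>0 <#\<^bsub>grp \<R>\<^esub> s \<in> S) \<and>
     (\<forall>s \<in> S. \<forall>g \<in> s. (inv\<^bsub>grp \<R>\<^esub> g) <#\<^bsub>grp \<R>\<^esub> stab \<R> \<in> S) \<and>
     (\<forall>m. \<exists>ss. set ss \<subseteq> S \<and> m = foldl (semi_act \<R>) (orig \<R>) ss)"

definition edges :: "('g, 'm) cell_space \<Rightarrow> 'g set set \<Rightarrow> ('m \<times> 'm) set" where
  "edges \<R> S = {(m, semi_act \<R> m s) | m s. s \<in> S}"

text \<open>If \<open>S\<close> is a symmetric right generating set, then the edge relation is symmetric and the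
  graph is connected, so that some path exists between any two points.\<close>

definition path_dist :: "('g, 'm) cell_space \<Rightarrow> 'g set set \<Rightarrow> 'm \<Rightarrow> 'm \<Rightarrow> nat" where
  "path_dist \<R> S m m' = (LEAST k. (m, m') \<in> edges \<R> S ^^ k)"

definition set_path_dist :: "('g, 'm) cell_space \<Rightarrow> 'g set set \<Rightarrow> 'm set \<Rightarrow> 'm set \<Rightarrow> enat" where
  "set_path_dist \<R> S A B = (INF (a, b) \<in> A \<times> B. enat (path_dist \<R> S a b))"

definition path_ball :: "('g, 'm) cell_space \<Rightarrow> 'g set set \<Rightarrow> 'm \<Rightarrow> nat \<Rightarrow> 'm set" where
  "path_ball \<R> S m \<rho> = {m'. path_dist \<R> S m m' \<le> \<rho>}"

definition inner :: "('g, 'm) cell_space \<Rightarrow> 'g set set \<Rightarrow> nat \<Rightarrow> 'm set \<Rightarrow> 'm set" where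
  "inner \<R> S \<theta> A = {m \<in> A. path_ball \<R> S m \<theta> \<subseteq> A}"

definition outer :: "('g, 'm) cell_space \<Rightarrow> 'g set set \<Rightarrow> nat \<Rightarrow> 'm set \<Rightarrow> 'm set" where
  "outer \<R> S \<theta> A = {m. path_ball \<R> S m \<theta> \<inter> A \<noteq> {}}"

definition bdry :: "('g, 'm) cell_space \<Rightarrow> 'g set set \<Rightarrow> nat \<Rightarrow> 'm set \<Rightarrow> 'm set" where
  "bdry \<R> S \<theta> A = outer \<R> S \<theta> A - inner \<R> S \<theta> A"

text \<open>An \<open>A\<close>-pattern is a partial map \<open>p\<close> with \<open>dom p = A\<close> and \<open>ran p \<subseteq> Q\<close>. In particular the
  elements of \<open>Q\<^sup>M\<close> are the patterns with domain \<open>UNIV\<close>, and the restriction of \<open>p\<close> to \<open>B\<close> is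
  \<open>p |` B\<close>.\<close>

definition finite_pattern :: "'q set \<Rightarrow> ('m \<rightharpoonup> 'q) \<Rightarrow> bool" where
  "finite_pattern Q p \<longleftrightarrow> finite (dom p) \<and> ran p \<subseteq> Q"

definition full_shift :: "'q set \<Rightarrow> ('m \<rightharpoonup> 'q) set" where
  "full_shift Q = {c. dom c = UNIV \<and> ran c \<subseteq> Q}"

definition pat_act :: "('g, 'm) cell_space \<Rightarrow> 'g \<Rightarrow> ('m \<rightharpoonup> 'q) \<Rightarrow> ('m \<rightharpoonup> 'q)" where
  "pat_act \<R> g p = (\<lambda>m. p (act \<R> (inv\<^bsub>grp \<R>\<^esub> g) m))"

definition semi_occurs ::
  "('g, 'm) cell_space \<Rightarrow> 'g set \<Rightarrow> ('m \<rightharpoonup> 'q) \<Rightarrow> ('m \<rightharpoonup> 'q) \<Rightarrow> bool" where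
  "semi_occurs \<R> H p p' \<longleftrightarrow>
     (\<exists>h \<in> H. act \<R> h ` dom p \<subseteq> dom p' \<and> pat_act \<R> h p = p' |` (act \<R> h ` dom p))"

definition shift_avoiding ::
  "('g, 'm) cell_space \<Rightarrow> 'g set \<Rightarrow> 'q set \<Rightarrow> ('m \<rightharpoonup> 'q) set \<Rightarrow> ('m \<rightharpoonup> 'q) set" where
  "shift_avoiding \<R> H Q \<FF> = {c \<in> full_shift Q. \<forall>f \<in> \<FF>. \<not> semi_occurs \<R> H f c}"

definition subshift ::
  "('g, 'm) cell_space \<Rightarrow> 'g set \<Rightarrow> 'q set \<Rightarrow> ('m \<rightharpoonup> 'q) set \<Rightarrow> bool" where
  "subshift \<R> H Q X \<longleftrightarrow>
     (\<exists>\<FF>. (\<forall>f \<in> \<FF>. finite_pattern Q f) \<and> X = shift_avoiding \<R> H Q \<FF>)"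

definition subshift_finite_type ::
  "('g, 'm) cell_space \<Rightarrow> 'g set \<Rightarrow> 'q set \<Rightarrow> ('m \<rightharpoonup> 'q) set \<Rightarrow> bool" where
  "subshift_finite_type \<R> H Q X \<longleftrightarrow>
     (\<exists>\<FF>. finite \<FF> \<and> (\<forall>f \<in> \<FF>. finite_pattern Q f) \<and> X = shift_avoiding \<R> H Q \<FF>)"

definition allowed ::
  "('g, 'm) cell_space \<Rightarrow> 'g set \<Rightarrow> ('m \<rightharpoonup> 'q) set \<Rightarrow> ('m \<rightharpoonup> 'q) \<Rightarrow> bool" where
  "allowed \<R> H X p \<longleftrightarrow> (\<exists>x \<in> X. semi_occurs \<R> H p x)"

definition restrictions :: "('m \<rightharpoonup> 'q) set \<Rightarrow> 'm set \<Rightarrow> ('m \<rightharpoonup> 'q) set" where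
  "restrictions X A = (\<lambda>x. x |` A) ` X"

definition strongly_irreducible_with ::
  "('g, 'm) cell_space \<Rightarrow> 'g set set \<Rightarrow> 'g set \<Rightarrow> 'q set \<Rightarrow> nat \<Rightarrow> ('m \<rightharpoonup> 'q) set \<Rightarrow> bool" where
  "strongly_irreducible_with \<R> S H Q \<kappa> X \<longleftrightarrow>
     (\<forall>p p'. finite_pattern Q p \<and> finite_pattern Q p' \<and>
        allowed \<R> H X p \<and> allowed \<R> H X p' \<and>
        set_path_dist \<R> S (dom p) (dom p') \<ge> enat (\<kappa> + 1) \<longrightarrow>
        (\<exists>x \<in> X. x |` dom p = p \<and> x |` dom p' = p'))"

definition strongly_irreducible ::
  "('g, 'm) cell_space \<Rightarrow> 'g set set \<Rightarrow> 'g set \<Rightarrow> 'q set \<Rightarrow> ('m \<rightharpoonup> 'q) set \<Rightarrow> bool" where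
  "strongly_irreducible \<R> S H Q X \<longleftrightarrow> (\<exists>\<kappa>. strongly_irreducible_with \<R> S H Q \<kappa> X)"

definition local_map_with ::
  "('g, 'm) cell_space \<Rightarrow> 'g set set \<Rightarrow> 'g set \<Rightarrow> 'q set \<Rightarrow> nat \<Rightarrow>
   ('m \<rightharpoonup> 'q) set \<Rightarrow> ('m \<rightharpoonup> 'q) set \<Rightarrow> (('m \<rightharpoonup> 'q) \<Rightarrow> ('m \<rightharpoonup> 'q)) \<Rightarrow> bool" where
  "local_map_with \<R> S H Q \<kappa> X Y \<Delta> \<longleftrightarrow>
     \<Delta> \<in> X \<rightarrow> Y \<and>
     (\<exists>N \<subseteq> path_ball \<R> S (orig \<R>) \<kappa>. \<exists>\<delta> \<in> restrictions X N \<rightarrow> Q.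
        (\<forall>g\<^sub>0 \<in> stab \<R>. act \<R> g\<^sub>0 ` N \<subseteq> N) \<and>
        (\<forall>h\<^sub>0 \<in> H \<inter> stab \<R>. \<forall>l \<in> restrictions X N. \<delta> (pat_act \<R> h\<^sub>0 l) = \<delta> l) \<and>
        (\<forall>x \<in> X. \<forall>m. \<Delta> x m = Some (\<delta> ((\<lambda>n. x (semi_act_pt \<R> m n)) |` N))))"

definition local_map ::
  "('g, 'm) cell_space \<Rightarrow> 'g set set \<Rightarrow> 'g set \<Rightarrow> 'q set \<Rightarrow>
   ('m \<rightharpoonup> 'q) set \<Rightarrow> ('m \<rightharpoonup> 'q) set \<Rightarrow> (('m \<rightharpoonup> 'q) \<Rightarrow> ('m \<rightharpoonup> 'q)) \<Rightarrow> bool" where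
  "local_map \<R> S H Q X Y \<Delta> \<longleftrightarrow> (\<exists>\<kappa>. local_map_with \<R> S H Q \<kappa> X Y \<Delta>)"

definition pre_injective :: "('m \<rightharpoonup> 'q) set \<Rightarrow> (('m \<rightharpoonup> 'q) \<Rightarrow> ('m \<rightharpoonup> 'q)) \<Rightarrow> bool" where
  "pre_injective X \<Delta> \<longleftrightarrow>
     (\<forall>x \<in> X. \<forall>x' \<in> X. finite {m. x m \<noteq> x' m} \<and> \<Delta> x = \<Delta> x' \<longrightarrow> x = x')"

definition right_amenable :: "('g, 'm) cell_space \<Rightarrow> bool" where
  "right_amenable \<R> \<longleftrightarrow>
     (\<exists>\<mu> :: 'm set \<Rightarrow> real.
        (\<forall>A. 0 \<le> \<mu> A) \<and> \<mu> UNIV = 1 \<and>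
        (\<forall>A B. A \<inter> B = {} \<longrightarrow> \<mu> (A \<union> B) = \<mu> A + \<mu> B) \<and>
        (\<forall>\<gg> \<in> cosets \<R>. \<forall>A. inj_on (\<lambda>m. semi_act \<R> m \<gg>) A \<longrightarrow>
           \<mu> ((\<lambda>m. semi_act \<R> m \<gg>) ` A) = \<mu> A))"

text \<open>A net is a family indexed by a directed set \<open>(I, \<preceq>)\<close>; its limits and limits superior are
  those along the filter generated by the tails of \<open>I\<close>.\<close>

definition directed_set :: "'i set \<Rightarrow> ('i \<Rightarrow> 'i \<Rightarrow> bool) \<Rightarrow> bool" where
  "directed_set I rel \<longleftrightarrow> I \<noteq> {} \<and> reflp_on I rel \<and> transp_on I rel \<and>
     (\<forall>i \<in> I. \<forall>j \<in> I. \<exists>k \<in> I. rel i k \<and> rel j k)"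

definition tails :: "'i set \<Rightarrow> ('i \<Rightarrow> 'i \<Rightarrow> bool) \<Rightarrow> 'i filter" where
  "tails I rel = (INF i \<in> I. principal {j \<in> I. rel i j})"

definition right_folner_net ::
  "('g, 'm) cell_space \<Rightarrow> 'g set set \<Rightarrow> 'i set \<Rightarrow> ('i \<Rightarrow> 'i \<Rightarrow> bool) \<Rightarrow> ('i \<Rightarrow> 'm set) \<Rightarrow> bool" where
  "right_folner_net \<R> S I rel F \<longleftrightarrow>
     directed_set I rel \<and>
     (\<forall>i \<in> I. finite (F i) \<and> F i \<noteq> {}) \<and>
     (\<forall>\<rho>. ((\<lambda>i. real (card (bdry \<R> S \<rho> (F i))) / real (card (F i))) \<longlongrightarrow> 0) (tails I rel))"

text \<open>Natural logarithm with \<open>log 0 = -\<infinity>\<close>, in contrast to \<^term>\<open>ln (0 :: real) = 0\<close>.\<close>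

definition log_ext :: "nat \<Rightarrow> ereal" where
  "log_ext n = (if n = 0 then - \<infinity> else ereal (ln (real n)))"

definition entropy ::
  "'i set \<Rightarrow> ('i \<Rightarrow> 'i \<Rightarrow> bool) \<Rightarrow> ('i \<Rightarrow> 'm set) \<Rightarrow> ('m \<rightharpoonup> 'q) set \<Rightarrow> ereal" where
  "entropy I rel F X =
     Limsup (tails I rel)
       (\<lambda>i. log_ext (card (restrictions X (F i))) / ereal (real (card (F i))))"

end

theory Submission
  imports Defs
begin

text \<open>Let \<open>x \<noteq> x'\<close> in \<open>X\<close> have the same image and differ only in a ball about \<open>m\<^sub>0\<close>. As \<open>X\<close> is of
  finite type and \<open>\<Delta>\<close> is local, in any configuration that contains a translate of \<open>x\<close> on a
  large ball, this pattern can be replaced by the translate of \<open>x'\<close> without leaving \<open>X\<close> or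
  changing the image. Hence, for a finite set \<open>F\<close> and a separated set \<open>T\<close> of points deep inside
  \<open>F\<close>, every image is the image of a configuration that avoids the translates of \<open>x\<close> at all points
  of \<open>T\<close>. By strong irreducibility each \<open>t \<in> T\<close> at which a pattern is forbidden decreases the
  number of patterns on \<open>F\<close> by a constant factor \<open>\<theta> < 1\<close>, and \<open>T\<close> can be chosen with \<open>card T\<close> at
  least proportional to \<open>card F\<close> up to a boundary term, which vanishes along the net.\<close>

section \<open>The metric of a finitely right generated cell space\<close>

locale generated_cell_space =
  fixes \<R> :: "('g, 'm) cell_space" and S :: "'g set set"
  assumes cell_space: "is_cell_space \<R>"
    and finite_gen: "finite S"
    and sym_gen: "sym_right_generating \<R> S"

sublocale generated_cell_space \<subseteq> transitive_action "grp \<R>" UNIV "act \<R>"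
  using cell_space by (simp add: is_cell_space_def)

sublocale generated_cell_space \<subseteq> group "grp \<R>"
  using group_hom group_hom.axioms(1) by blast

context generated_cell_space
begin

abbreviation mul (infixl \<open>\<odot>\<close> 70) where "g \<odot> h \<equiv> g \<otimes>\<^bsub>grp \<R>\<^esub> h"
abbreviation act_on (infixr \<open>\<rhd>\<close> 75) where "g \<rhd> m \<equiv> act \<R> g m"
abbreviation o\<^sub>M where "o\<^sub>M \<equiv> orig \<R>"
abbreviation Gr where "Gr \<equiv> carrier (grp \<R>)"
abbreviation iv where "iv g \<equiv> inv\<^bsub>grp \<R>\<^esub> g"
abbreviation ball where "ball \<equiv> path_ball \<R> S"
abbreviation d where "d \<equiv> path_dist \<R> S"

section \<open>The left action, stabiliser cosets and the semi-action\<close>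

lemma act_mult: "g \<in> Gr \<Longrightarrow> h \<in> Gr \<Longrightarrow> (g \<odot> h) \<rhd> m = g \<rhd> h \<rhd> m"
  using composition_rule by simp

lemma act_inv_act [simp]: "g \<in> Gr \<Longrightarrow> iv g \<rhd> g \<rhd> m = m"
  using orbit_sym_aux by blast

lemma act_act_inv [simp]: "g \<in> Gr \<Longrightarrow> g \<rhd> iv g \<rhd> m = m"
  by (metis act_inv_act inv_closed inv_inv)

lemma act_eq_iff [simp]: "g \<in> Gr \<Longrightarrow> g \<rhd> m = g \<rhd> n \<longleftrightarrow> m = n"
  by (metis act_inv_act)

lemma coord_closed [simp]: "coord \<R> m \<in> Gr" and coord_orig [simp]: "coord \<R> m \<rhd> o\<^sub>M = m"
  using cell_space by (auto simp: is_cell_space_def)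

lemma stab_iff: "g \<in> stab \<R> \<longleftrightarrow> g \<in> Gr \<and> g \<rhd> o\<^sub>M = o\<^sub>M"
  by (auto simp: stab_def stabilizer_def)

lemma coset_of_iff: "g \<in> coset_of \<R> n \<longleftrightarrow> g \<in> Gr \<and> g \<rhd> o\<^sub>M = n"
  by (auto simp: coset_of_def)

text \<open>The identification of \<open>M\<close> with the cosets is equivariant; closure
  conditions on \<open>S\<close> thereby become conditions on points.\<close>

lemma l_coset_coset_of:
  assumes "g \<in> Gr"
  shows "g <#\<^bsub>grp \<R>\<^esub> coset_of \<R> n = coset_of \<R> (g \<rhd> n)"
proof (intro equalityI subsetI)
  fix h assume "h \<in> coset_of \<R> (g \<rhd> n)"
  then have "h \<in> Gr" "iv g \<odot> h \<in> coset_of \<R> n" "h = g \<odot> (iv g \<odot> h)"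
    using assms by (auto simp: coset_of_iff act_mult m_assoc[symmetric])
  then show "h \<in> g <#\<^bsub>grp \<R>\<^esub> coset_of \<R> n"
    by (auto simp: l_coset_def)
qed (use assms in \<open>auto simp: l_coset_def coset_of_iff act_mult\<close>)

lemma stab_eq_coset_of: "stab \<R> = coset_of \<R> o\<^sub>M"
  by (auto simp: stab_iff coset_of_iff)

lemma cosets_eq: "cosets \<R> = range (coset_of \<R>)"
proof -
  have "coset_of \<R> m \<in> cosets \<R>" for m
    using l_coset_coset_of[of "coord \<R> m" o\<^sub>M]
    by (auto simp: cosets_def LCOSETS_def stab_eq_coset_of intro!: bexI[of _ "coord \<R> m"])
  then show ?thesis
    by (auto simp: cosets_def LCOSETS_def stab_eq_coset_of l_coset_coset_of)
qed

text \<open>Every representative of the coset carries the origin to \<open>n\<close>, and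
  \<open>coord \<R> n\<close> is one of them; so the image in \<open>semi_act\<close> is a
  singleton.\<close>

lemma semi_act_coset_of: "semi_act \<R> m (coset_of \<R> n) = coord \<R> m \<rhd> n"
proof -
  have "(\<lambda>g. (coord \<R> m \<odot> g) \<rhd> o\<^sub>M) ` coset_of \<R> n = {coord \<R> m \<rhd> n}"
  proof (rule antisym)
    show "(\<lambda>g. (coord \<R> m \<odot> g) \<rhd> o\<^sub>M) ` coset_of \<R> n \<subseteq> {coord \<R> m \<rhd> n}"
      by (auto simp: coset_of_iff act_mult)
    show "{coord \<R> m \<rhd> n} \<subseteq> (\<lambda>g. (coord \<R> m \<odot> g) \<rhd> o\<^sub>M) ` coset_of \<R> n"
      by (auto intro!: image_eqI[of _ _ "coord \<R> n"] simp: coset_of_iff act_mult)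
  qed
  then show ?thesis
    by (simp add: semi_act_def)
qed

lemma semi_act_pt_eq: "semi_act_pt \<R> m n = coord \<R> m \<rhd> n"
  by (simp add: semi_act_pt_def semi_act_coset_of)

section \<open>The edge graph and its invariance under the group\<close>

definition nbrs :: "'m set" where
  "nbrs = {n. coset_of \<R> n \<in> S}"

lemma stab_nbrs: "g \<in> stab \<R> \<Longrightarrow> n \<in> nbrs \<Longrightarrow> g \<rhd> n \<in> nbrs"
  using sym_gen l_coset_coset_of[of g n]
  unfolding sym_right_generating_def nbrs_def stab_iff by (metis mem_Collect_eq stab_iff)

lemma inv_nbrs: "g \<in> Gr \<Longrightarrow> g \<rhd> o\<^sub>M \<in> nbrs \<Longrightarrow> iv g \<rhd> o\<^sub>M \<in> nbrs"
  using sym_gen l_coset_coset_of[of "iv g" "o\<^sub>M"]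
  unfolding sym_right_generating_def nbrs_def stab_eq_coset_of
  by (metis coset_of_iff inv_closed mem_Collect_eq)

text \<open>\<open>semi_act\<close> refers to the chosen \<open>coord \<R> m\<close>, which need not
  be equivariant. Any other \<open>g\<close> carrying the origin to \<open>m\<close> differs from it
  by a stabiliser element, which preserves \<open>nbrs\<close>; this form makes invariance of the
  edges visible.\<close>

lemma edges_iff: "(m, m') \<in> edges \<R> S \<longleftrightarrow> (\<exists>g\<in>Gr. \<exists>n\<in>nbrs. m = g \<rhd> o\<^sub>M \<and> m' = g \<rhd> n)"
proof
  assume "(m, m') \<in> edges \<R> S"
  then obtain s where s: "s \<in> S" "m' = semi_act \<R> m s"
    by (auto simp: edges_def)
  then obtain n where "s = coset_of \<R> n"
    using sym_gen cosets_eq by (auto simp: sym_right_generating_def)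
  with s show "\<exists>g\<in>Gr. \<exists>n\<in>nbrs. m = g \<rhd> o\<^sub>M \<and> m' = g \<rhd> n"
    by (intro bexI[of _ "coord \<R> m"] bexI[of _ n]) (auto simp: semi_act_coset_of nbrs_def)
next
  assume "\<exists>g\<in>Gr. \<exists>n\<in>nbrs. m = g \<rhd> o\<^sub>M \<and> m' = g \<rhd> n"
  then obtain g n where g: "g \<in> Gr" "n \<in> nbrs" "m = g \<rhd> o\<^sub>M" "m' = g \<rhd> n"
    by blast
  let ?h = "iv (coord \<R> m) \<odot> g"
  have "?h \<in> stab \<R>"
    using g act_inv_act[of "coord \<R> m" o\<^sub>M] by (simp add: stab_iff act_mult)
  then have "?h \<rhd> n \<in> nbrs"
    using g stab_nbrs by blast
  moreover have "m' = semi_act \<R> m (coset_of \<R> (?h \<rhd> n))"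
    using g by (simp add: semi_act_coset_of act_mult)
  ultimately show "(m, m') \<in> edges \<R> S"
    by (auto simp: edges_def nbrs_def)
qed

lemma edges_sym: "(m, m') \<in> edges \<R> S \<Longrightarrow> (m', m) \<in> edges \<R> S"
proof -
  assume "(m, m') \<in> edges \<R> S"
  then obtain g n where g: "g \<in> Gr" "n \<in> nbrs" "m = g \<rhd> o\<^sub>M" "m' = g \<rhd> n"
    by (auto simp: edges_iff)
  then show ?thesis
    \<comment> \<open>The reversed edge is based at \<open>g \<odot> coord \<R> n\<close>, which
      carries the origin to \<open>m'\<close>.\<close>
    unfolding edges_iff using inv_nbrs[of "coord \<R> n"]
    by (intro bexI[of _ "g \<odot> coord \<R> n"] bexI[of _ "iv (coord \<R> n) \<rhd> o\<^sub>M"])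
      (auto simp: act_mult)
qed

lemma edges_act: "g \<in> Gr \<Longrightarrow> (m, m') \<in> edges \<R> S \<Longrightarrow> (g \<rhd> m, g \<rhd> m') \<in> edges \<R> S"
  unfolding edges_iff by (metis act_mult m_closed)

lemma relpow_edges_sym: "(m, m') \<in> edges \<R> S ^^ k \<Longrightarrow> (m', m) \<in> edges \<R> S ^^ k"
proof (induction k arbitrary: m')
  case (Suc k)
  then show ?case
    by (meson edges_sym relpow_Suc_D2' relpow_Suc_E relpow_Suc_I2)
qed simp

lemma relpow_edges_act:
  "g \<in> Gr \<Longrightarrow> (m, m') \<in> edges \<R> S ^^ k \<Longrightarrow> (g \<rhd> m, g \<rhd> m') \<in> edges \<R> S ^^ k"
proof (induction k arbitrary: m')
  case (Suc k)
  then show ?case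
    by (meson edges_act relpow_Suc_E relpow_Suc_I)
qed simp

lemma orig_reachable: "(o\<^sub>M, m) \<in> (edges \<R> S)\<^sup>*"
proof -
  obtain ss where ss: "set ss \<subseteq> S" "m = foldl (semi_act \<R>) o\<^sub>M ss"
    using sym_gen unfolding sym_right_generating_def by blast
  have "set ss \<subseteq> S \<Longrightarrow> (a, foldl (semi_act \<R>) a ss) \<in> (edges \<R> S)\<^sup>*" for a
  proof (induction ss arbitrary: a)
    case (Cons s ss)
    then have "(a, semi_act \<R> a s) \<in> edges \<R> S"
      by (auto simp: edges_def)
    with Cons show ?case
      by (auto intro: converse_rtrancl_into_rtrancl)
  qed simp
  with ss show ?thesis by blast
qed

text \<open>The path runs through the origin: generation gives paths from there, and symmetry
  reverses the first one.\<close>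

lemma reachable: "\<exists>k. (m, m') \<in> edges \<R> S ^^ k"
proof -
  obtain k l where "(o\<^sub>M, m) \<in> edges \<R> S ^^ k" "(o\<^sub>M, m') \<in> edges \<R> S ^^ l"
    using orig_reachable by (meson rtrancl_imp_relpow)
  then have "(m, m') \<in> edges \<R> S ^^ (k + l)"
    using relpow_edges_sym unfolding relpow_add by blast
  then show ?thesis ..
qed

section \<open>The path metric and its balls\<close>

lemma relpow_dist: "(m, m') \<in> edges \<R> S ^^ d m m'"
  unfolding path_dist_def using reachable by (rule LeastI_ex)

lemma dist_le: "(m, m') \<in> edges \<R> S ^^ k \<Longrightarrow> d m m' \<le> k"
  unfolding path_dist_def by (rule Least_le)

lemma dist_refl [simp]: "d m m = 0"
  using dist_le[of m m 0] by simp

lemma dist_sym: "d m m' = d m' m"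
  by (meson antisym dist_le relpow_dist relpow_edges_sym)

lemma dist_triangle: "d m m'' \<le> d m m' + d m' m''"
  by (rule dist_le) (auto simp: relpow_add intro: relpow_dist)

text \<open>Paths are moved by \<open>g\<close> and back by its inverse. Invariance lets estimates
  at the origin be used at every centre.\<close>

lemma dist_act [simp]:
  assumes "g \<in> Gr" shows "d (g \<rhd> m) (g \<rhd> m') = d m m'"
proof (rule antisym)
  show "d m m' \<le> d (g \<rhd> m) (g \<rhd> m')"
    using relpow_edges_act[OF inv_closed[OF assms] relpow_dist, of "g \<rhd> m" "g \<rhd> m'"] assms
    by (intro dist_le) simp
qed (rule dist_le[OF relpow_edges_act[OF assms relpow_dist]])

lemma in_ball: "m' \<in> ball m r \<longleftrightarrow> d m m' \<le> r"
  by (simp add: path_ball_def)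

lemma ball_act: "g \<in> Gr \<Longrightarrow> ball (g \<rhd> m) r = act \<R> g ` ball m r"
proof (intro equalityI subsetI)
  fix n assume g: "g \<in> Gr" "n \<in> ball (g \<rhd> m) r"
  then have "iv g \<rhd> n \<in> ball m r"
    using dist_act[of g m "iv g \<rhd> n"] by (simp add: in_ball)
  with g show "n \<in> act \<R> g ` ball m r"
    by (metis act_act_inv image_eqI)
qed (auto simp: in_ball)

lemma finite_relpow_Image: "finite ((edges \<R> S ^^ k) `` {m})"
proof (induction k)
  case (Suc k)
  have "edges \<R> S `` A = (\<Union>a\<in>A. semi_act \<R> a ` S)" for A
    by (auto simp: edges_def)
  then show ?case
    using Suc finite_gen by (simp add: relcomp_Image)
qed simp

lemma finite_ball [simp]: "finite (ball m r)"
proof (rule finite_subset)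
  show "ball m r \<subseteq> (\<Union>k\<le>r. (edges \<R> S ^^ k) `` {m})"
    using relpow_dist[of m] by (auto simp: in_ball)
qed (simp add: finite_relpow_Image)

lemma card_ball: "card (ball m r) = card (ball o\<^sub>M r)"
proof -
  have "inj_on (act \<R> (coord \<R> m)) (ball o\<^sub>M r)"
    by (auto simp: inj_on_def)
  then show ?thesis
    using ball_act[of "coord \<R> m" o\<^sub>M r] by (simp add: card_image)
qed

text \<open>Take \<open>T\<close> maximal: then the balls of radius \<open>2r\<close> about \<open>T\<close> cover the \<open>r\<close>-interior.\<close>

lemma separated_subset_exists:
  assumes "finite A"
  obtains T where "T \<subseteq> inner \<R> S r A"
    and "\<And>s t. s \<in> T \<Longrightarrow> t \<in> T \<Longrightarrow> s \<noteq> t \<Longrightarrow> 2 * r < d s t"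
    and "card (inner \<R> S r A) \<le> card (ball o\<^sub>M (2 * r)) * card T"
proof -
  let ?J = "inner \<R> S r A"
  let ?sep = "\<lambda>T. \<forall>s\<in>T. \<forall>t\<in>T. s \<noteq> t \<longrightarrow> 2 * r < d s t"
  have J: "finite ?J"
    using assms by (auto simp: inner_def)
  define \<S> where "\<S> = {T \<in> Pow ?J. ?sep T}"
  have "finite \<S>" "{} \<in> \<S>"
    using J by (simp_all add: \<S>_def)
  then obtain T where "T \<in> \<S>" and max: "\<And>T'. T' \<in> \<S> \<Longrightarrow> T \<subseteq> T' \<Longrightarrow> T = T'"
    using finite_has_maximal[of \<S>] by blast
  then have T: "T \<subseteq> ?J" "?sep T"
    by (simp_all add: \<S>_def)
  have "?J \<subseteq> (\<Union>t\<in>T. ball t (2 * r))"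
  proof
    fix m assume m: "m \<in> ?J"
    show "m \<in> (\<Union>t\<in>T. ball t (2 * r))"
    proof (rule ccontr)
      assume *: "m \<notin> (\<Union>t\<in>T. ball t (2 * r))"
      then have "\<And>t. t \<in> T \<Longrightarrow> 2 * r < d t m \<and> 2 * r < d m t"
        by (simp add: in_ball not_le dist_sym[of m])
      with T(2) have "?sep (insert m T)"
        by blast
      with m T(1) have "T = insert m T"
        by (intro max) (auto simp: \<S>_def)
      then have "m \<in> T"
        by blast
      then show False
        using * by (auto simp: in_ball)
    qed
  qed
  moreover have "finite T"
    using T(1) J finite_subset by blast
  ultimately have "card ?J \<le> card (\<Union>t\<in>T. ball t (2 * r))"
    by (intro card_mono) auto
  also have "\<dots> \<le> (\<Sum>t\<in>T. card (ball t (2 * r)))"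
    using \<open>finite T\<close> by (rule card_UN_le)
  also have "\<dots> = card (ball o\<^sub>M (2 * r)) * card T"
  proof -
    have "(\<Sum>t\<in>T. card (ball t (2 * r))) = (\<Sum>t\<in>T. card (ball o\<^sub>M (2 * r)))"
      by (intro sum.cong refl card_ball)
    then show ?thesis by simp
  qed
  finally show ?thesis
    using that[OF T(1)] T(2) by blast
qed

end

section \<open>Patterns\<close>

text \<open>\<open>A\<close> is the union of its fibres over \<open>B\<close>. In the applications
  \<open>f\<close> forgets or alters values on a finite set of cells, so fibres are small.\<close>

lemma card_le_fibres:
  assumes "finite B" "f ` A \<subseteq> B"
    and "\<And>b. b \<in> B \<Longrightarrow> card {a \<in> A. f a = b} \<le> k"
    and "\<And>b. b \<in> B \<Longrightarrow> finite {a \<in> A. f a = b}"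
  shows "card A \<le> k * card B"
proof -
  have "A = (\<Union>b\<in>B. {a \<in> A. f a = b})"
    using assms(2) by auto
  then have "card A \<le> (\<Sum>b\<in>B. card {a \<in> A. f a = b})"
    using card_UN_le[OF assms(1), of "\<lambda>b. {a \<in> A. f a = b}"] by simp
  also have "\<dots> \<le> (\<Sum>b\<in>B. k)"
    using assms(3) by (rule sum_mono)
  finally show ?thesis
    by (simp add: mult.commute)
qed

text \<open>On \<open>Z\<close> the map \<open>g\<close> factors through \<open>f\<close>. This will
  compare images on a set with configurations on a neighbourhood of it.\<close>

lemma card_image_le_if_determined:
  assumes "finite (f ` Z)" "\<And>z z'. z \<in> Z \<Longrightarrow> z' \<in> Z \<Longrightarrow> f z = f z' \<Longrightarrow> g z = g z'"
  shows "card (g ` Z) \<le> card (f ` Z)"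
proof -
  have "g ` Z \<subseteq> (\<lambda>p. g (inv_into Z f p)) ` f ` Z"
  proof
    fix p assume "p \<in> g ` Z"
    then obtain z where z: "z \<in> Z" "p = g z" by blast
    then have "g (inv_into Z f (f z)) = g z"
      by (intro assms(2)) (auto simp: inv_into_into f_inv_into_f)
    with z show "p \<in> (\<lambda>p. g (inv_into Z f p)) ` f ` Z"
      by (metis imageI)
  qed
  with assms(1) show ?thesis
    by (rule surj_card_le)
qed

text \<open>A member of \<open>P\<close> is determined by its values on \<open>A\<close>, which
  embeds \<open>P\<close> into the functions from \<open>A\<close> to \<open>Q\<close>. The map
  \<open>c\<close> prescribes the rest; it is \<open>Map.empty\<close> for patterns with domain
  \<open>A\<close>.\<close>

lemma card_patterns_agreeing_off:
  fixes P :: "('m \<rightharpoonup> 'q) set"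
  assumes "finite A" "finite Q"
    and off: "\<And>p m. p \<in> P \<Longrightarrow> m \<notin> A \<Longrightarrow> p m = c m"
    and on: "\<And>p m. p \<in> P \<Longrightarrow> m \<in> A \<Longrightarrow> p m \<in> Some ` Q"
  shows "finite P" "card P \<le> card Q ^ card A"
proof -
  let ?\<phi> = "\<lambda>p. restrict (\<lambda>m. the (p m)) A"
  have inj: "inj_on ?\<phi> P"
  proof (rule inj_onI, rule ext)
    fix p p' m assume p: "p \<in> P" "p' \<in> P" "?\<phi> p = ?\<phi> p'"
    show "p m = p' m"
    proof (cases "m \<in> A")
      case True
      then have "the (p m) = the (p' m)"
        using fun_cong[OF p(3), of m] by simp
      with on[OF p(1) True] on[OF p(2) True] show ?thesis by auto
    qed (use off[OF p(1)] off[OF p(2)] in simp)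
  qed
  have sub: "?\<phi> ` P \<subseteq> (\<Pi>\<^sub>E m\<in>A. Q)"
  proof
    fix \<psi> assume "\<psi> \<in> ?\<phi> ` P"
    then obtain p where p: "p \<in> P" "\<psi> = ?\<phi> p" by blast
    have "the (p m) \<in> Q" if "m \<in> A" for m
      using on[OF p(1) that] by auto
    with p(2) show "\<psi> \<in> (\<Pi>\<^sub>E m\<in>A. Q)"
      by simp
  qed
  have fin: "finite (\<Pi>\<^sub>E m\<in>A. Q)"
    using assms by (intro finite_PiE) auto
  show "finite P"
    using inj sub fin by (rule inj_on_finite)
  have "card P \<le> card (\<Pi>\<^sub>E m\<in>A. Q)"
    using inj sub fin by (rule card_inj_on_le)
  then show "card P \<le> card Q ^ card A"
    using assms(1) by (simp add: card_PiE)
qed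

lemma full_shift_iff: "c \<in> full_shift Q \<longleftrightarrow> (\<forall>m. c m \<in> Some ` Q)"
proof
  assume "c \<in> full_shift Q"
  then have "dom c = UNIV" "ran c \<subseteq> Q"
    by (auto simp: full_shift_def)
  then show "\<forall>m. c m \<in> Some ` Q"
    by (metis UNIV_I domD image_eqI ranI subsetD)
next
  assume c: "\<forall>m. c m \<in> Some ` Q"
  then have "q \<in> Q" if "c m = Some q" for m q
    using that by (metis (no_types, lifting) imageE option.inject)
  moreover have "c m \<noteq> None" for m
    using c by (metis imageE option.discI)
  ultimately show "c \<in> full_shift Q"
    by (auto simp: full_shift_def ran_def dom_def)
qed

lemma restrict_map_eq_iff: "f |` A = g |` A \<longleftrightarrow> (\<forall>m\<in>A. f m = g m)"
  by (auto simp: restrict_map_def fun_eq_iff)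

lemma finite_restrictions:
  assumes "finite A" "finite Q" "V \<subseteq> full_shift Q"
  shows "finite (restrictions V A)"
  using assms
  by (intro card_patterns_agreeing_off(1)[where c = Map.empty and A = A and Q = Q])
    (auto simp: restrictions_def full_shift_iff)

lemma card_restrictions_le:
  assumes "finite A" "finite Q" "V \<subseteq> full_shift Q"
  shows "card (restrictions V A) \<le> card Q ^ card A"
  using assms
  by (intro card_patterns_agreeing_off(2)[where c = Map.empty])
    (auto simp: restrictions_def full_shift_iff)

text \<open>Restricting to \<open>A\<close> forgets only values on \<open>B\<close>, which bounds
  each fibre.\<close>

lemma card_restrictions_Un:
  assumes "finite A" "finite B" "finite Q" "V \<subseteq> full_shift Q"
  shows "card (restrictions V (A \<union> B)) \<le> card Q ^ card B * card (restrictions V A)"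
proof (rule card_le_fibres)
  show "finite (restrictions V A)"
    using assms by (intro finite_restrictions)
  show "(\<lambda>p. p |` A) ` restrictions V (A \<union> B) \<subseteq> restrictions V A"
    by (auto simp: restrictions_def Int_absorb1)
  fix b
  let ?P = "{p \<in> restrictions V (A \<union> B). p |` A = b}"
  have off: "p m = b m" if "p \<in> ?P" "m \<notin> B" for p m
    using that by (auto simp: restrictions_def restrict_map_def)
  have on: "p m \<in> Some ` Q" if "p \<in> ?P" "m \<in> B" for p m
    using that assms(4) by (auto simp: restrictions_def restrict_map_def full_shift_iff)
  show "finite ?P"
    by (rule card_patterns_agreeing_off(1)[OF assms(2,3), where c = b]; erule off on; assumption)
  show "card ?P \<le> card Q ^ card B"
    by (rule card_patterns_agreeing_off(2)[OF assms(2,3), where c = b]; erule off on; assumption)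
qed

context generated_cell_space
begin

section \<open>Neighbourhoods, interiors and boundaries\<close>

lemma finite_outer: "finite A \<Longrightarrow> finite (outer \<R> S r A)"
proof (rule finite_subset)
  show "outer \<R> S r A \<subseteq> (\<Union>a\<in>A. ball a r)"
    using dist_sym by (auto simp: outer_def in_ball)
qed simp

lemma subset_outer: "A \<subseteq> outer \<R> S r A"
  by (force simp: outer_def in_ball)

lemma ball_subset_outer: "m \<in> A \<Longrightarrow> ball m r \<subseteq> outer \<R> S r A"
  using dist_sym by (auto simp: outer_def in_ball)

lemma finite_bdry: "finite A \<Longrightarrow> finite (bdry \<R> S r A)"
  by (simp add: bdry_def finite_outer)

text \<open>A separated set controls only the interior of \<open>A\<close>; the rest of
  \<open>A\<close> lies in the boundary and becomes an error term.\<close>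

lemma card_le_inner_bdry: "finite A \<Longrightarrow> card A \<le> card (inner \<R> S r A) + card (bdry \<R> S r A)"
proof -
  assume A: "finite A"
  have "A \<subseteq> inner \<R> S r A \<union> bdry \<R> S r A"
    using subset_outer by (auto simp: bdry_def)
  moreover have "finite (inner \<R> S r A \<union> bdry \<R> S r A)"
    using A finite_bdry by (auto simp: inner_def)
  ultimately have "card A \<le> card (inner \<R> S r A \<union> bdry \<R> S r A)"
    by (intro card_mono)
  then show ?thesis
    using card_Un_le le_trans by blast
qed

end

section \<open>Subshifts of finite type and local maps\<close>

locale shift_of_finite_type = generated_cell_space \<R> S
  for \<R> :: "('g, 'm) cell_space" and S +
  fixes H :: "'g set" and Q :: "'q set" and X :: "('m \<rightharpoonup> 'q) set"
  assumes subgroup_H: "subgroup H (grp \<R>)"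
    and coord_H: "coord \<R> m \<in> H"
    and finite_Q: "finite Q"
    and sft: "subshift_finite_type \<R> H Q X"
begin

lemma H_closed: "h \<in> H \<Longrightarrow> h \<in> Gr"
  using subgroup.mem_carrier[OF subgroup_H] .

text \<open>Evaluating both maps at \<open>h \<rhd> m\<close> moves the translation into the
  argument of \<open>c\<close>.\<close>

lemma semi_occurs_iff:
  assumes "dom c = UNIV"
  shows "semi_occurs \<R> H f c \<longleftrightarrow> (\<exists>h\<in>H. \<forall>m\<in>dom f. c (h \<rhd> m) = f m)"
proof -
  have "pat_act \<R> h f = c |` (act \<R> h ` dom f) \<longleftrightarrow> (\<forall>m\<in>dom f. c (h \<rhd> m) = f m)"
    if h: "h \<in> Gr" for h
  proof -
    have "pat_act \<R> h f = c |` (act \<R> h ` dom f) \<longleftrightarrow>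
        (\<forall>m. pat_act \<R> h f (h \<rhd> m) = (c |` (act \<R> h ` dom f)) (h \<rhd> m))"
      unfolding fun_eq_iff by (metis act_act_inv h)
    also have "\<dots> \<longleftrightarrow> (\<forall>m. f m = (if m \<in> dom f then c (h \<rhd> m) else None))"
      using h by (auto simp: pat_act_def restrict_map_def image_iff)
    also have "\<dots> \<longleftrightarrow> (\<forall>m\<in>dom f. c (h \<rhd> m) = f m)"
      by (auto simp: domIff)
    finally show ?thesis .
  qed
  then show ?thesis
    using assms H_closed by (auto simp: semi_occurs_def)
qed

lemma mem_shift_avoiding_iff:
  "c \<in> shift_avoiding \<R> H Q \<FF> \<longleftrightarrow>
     c \<in> full_shift Q \<and> (\<forall>f\<in>\<FF>. \<forall>h\<in>H. \<exists>m\<in>dom f. c (h \<rhd> m) \<noteq> f m)"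
proof (cases "c \<in> full_shift Q")
  case True
  then have "dom c = UNIV"
    by (simp add: full_shift_def)
  then show ?thesis
    by (simp add: shift_avoiding_def semi_occurs_iff)
qed (simp add: shift_avoiding_def)

lemma X_full: "X \<subseteq> full_shift Q"
  using sft by (auto simp: subshift_finite_type_def shift_avoiding_def)

lemma X_val: "x \<in> X \<Longrightarrow> x m \<in> Some ` Q"
  using subsetD[OF X_full, of x] by (simp add: full_shift_iff)

text \<open>An occurrence of \<open>f\<close> in the translate by way of \<open>k\<close> would be
  one in \<open>x\<close> by way of \<open>iv h \<odot> k\<close>, again in
  \<open>H\<close>.\<close>

lemma pat_act_X:
  assumes "h \<in> H" "x \<in> X" shows "pat_act \<R> h x \<in> X"
proof -
  obtain \<FF> where X: "X = shift_avoiding \<R> H Q \<FF>"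
    using sft by (auto simp: subshift_finite_type_def)
  have "iv h \<odot> k \<in> H" if "k \<in> H" for k
    using assms(1) that subgroup_H by (simp add: subgroup.m_closed subgroup.m_inv_closed)
  then have "\<exists>m\<in>dom f. x (iv h \<rhd> k \<rhd> m) \<noteq> f m" if "f \<in> \<FF>" "k \<in> H" for f k
    using assms that by (simp add: X mem_shift_avoiding_iff flip: act_mult add: H_closed)
  moreover have "pat_act \<R> h x \<in> full_shift Q"
    using X_val[OF assms(2)] by (simp add: full_shift_iff pat_act_def)
  ultimately show ?thesis
    by (simp add: X mem_shift_avoiding_iff pat_act_def)
qed

text \<open>Finitely many finite forbidden patterns fit into one ball about the origin. An
  occurrence by way of \<open>h\<close> is then visible in a ball about
  \<open>h \<rhd> o\<^sub>M\<close>, where \<open>c\<close> coincides with a member of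
  \<open>X\<close>.\<close>

lemma window:
  obtains \<sigma> where "\<And>c. (\<And>m. \<exists>u\<in>X. \<forall>n\<in>ball m \<sigma>. c n = u n) \<Longrightarrow> c \<in> X"
proof -
  obtain \<FF> where F: "finite \<FF>" "\<And>f. f \<in> \<FF> \<Longrightarrow> finite (dom f)"
    and X: "X = shift_avoiding \<R> H Q \<FF>"
    using sft by (auto simp: subshift_finite_type_def finite_pattern_def)
  \<comment> \<open>If all domains are empty, this \<open>Max\<close> is unspecified, but the bound
    below then concerns no point.\<close>
  define \<sigma> where "\<sigma> = Max (d o\<^sub>M ` (\<Union>f\<in>\<FF>. dom f))"
  have \<sigma>: "d o\<^sub>M m \<le> \<sigma>" if "f \<in> \<FF>" "m \<in> dom f" for f m
    unfolding \<sigma>_def using that F by (intro Max_ge) auto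
  have "c \<in> X" if c: "\<And>m. \<exists>u\<in>X. \<forall>n\<in>ball m \<sigma>. c n = u n" for c
  proof -
    have "c m \<in> Some ` Q" for m
      using c[of m] X_val by (metis dist_refl in_ball le0)
    moreover have "\<exists>m\<in>dom f. c (h \<rhd> m) \<noteq> f m" if f: "f \<in> \<FF>" "h \<in> H" for f h
    proof -
      obtain u where u: "u \<in> X" "\<And>n. n \<in> ball (h \<rhd> o\<^sub>M) \<sigma> \<Longrightarrow> c n = u n"
        using c by meson
      have "c (h \<rhd> m) = u (h \<rhd> m)" if "m \<in> dom f" for m
        using \<sigma>[OF f(1) that] f(2) by (intro u(2)) (simp add: in_ball H_closed)
      with u(1) f show ?thesis
        unfolding X mem_shift_avoiding_iff by metis
    qed
    ultimately show "c \<in> X"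
      by (simp add: X mem_shift_avoiding_iff full_shift_iff)
  qed
  with that show ?thesis by blast
qed

text \<open>The value at \<open>m\<close> reads only the cells \<open>coord \<R> m \<rhd> n\<close>
  with \<open>n \<in> N\<close>, and \<open>coord \<R> m\<close> is an isometry carrying the origin
  to \<open>m\<close>.\<close>

lemma local_map_window:
  assumes "local_map \<R> S H Q X Y \<Delta>"
  obtains \<tau> where "\<And>u v m. u \<in> X \<Longrightarrow> v \<in> X \<Longrightarrow> (\<And>n. n \<in> ball m \<tau> \<Longrightarrow> u n = v n) \<Longrightarrow> \<Delta> u m = \<Delta> v m"
proof -
  obtain \<tau> N \<delta> where N: "N \<subseteq> ball o\<^sub>M \<tau>"
    and \<Delta>: "\<And>x m. x \<in> X \<Longrightarrow> \<Delta> x m = Some (\<delta> ((\<lambda>n. x (coord \<R> m \<rhd> n)) |` N))"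
    using assms unfolding local_map_def local_map_with_def semi_act_pt_eq by metis
  have "\<Delta> u m = \<Delta> v m" if "u \<in> X" "v \<in> X" and eq: "\<And>n. n \<in> ball m \<tau> \<Longrightarrow> u n = v n" for u v m
  proof -
    have "coord \<R> m \<rhd> n \<in> ball m \<tau>" if "n \<in> N" for n
      using that N dist_act[of "coord \<R> m" o\<^sub>M n] by (auto simp: in_ball)
    then have "(\<lambda>n. u (coord \<R> m \<rhd> n)) |` N = (\<lambda>n. v (coord \<R> m \<rhd> n)) |` N"
      using eq by (simp add: restrict_map_eq_iff)
    then show ?thesis
      using that(1,2) by (simp add: \<Delta>)
  qed
  with that show ?thesis by blast
qed

text \<open>The chosen coordinates of \<open>m\<close> and \<open>iv h \<rhd> m\<close> need not
  correspond under \<open>h\<close>. Their discrepancy \<open>g\<close> lies in \<open>H\<close> and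
  fixes the origin, so the invariance of \<open>\<delta>\<close> absorbs it.\<close>

lemma local_map_equivariant:
  assumes "local_map \<R> S H Q X Y \<Delta>" and h: "h \<in> H" and x: "x \<in> X"
  shows "\<Delta> (pat_act \<R> h x) = pat_act \<R> h (\<Delta> x)"
proof
  fix m
  obtain N \<delta> where N: "\<And>g. g \<in> stab \<R> \<Longrightarrow> act \<R> g ` N \<subseteq> N"
    and \<delta>: "\<And>g l. g \<in> H \<inter> stab \<R> \<Longrightarrow> l \<in> restrictions X N \<Longrightarrow> \<delta> (pat_act \<R> g l) = \<delta> l"
    and \<Delta>: "\<And>x m. x \<in> X \<Longrightarrow> \<Delta> x m = Some (\<delta> ((\<lambda>n. x (coord \<R> m \<rhd> n)) |` N))"
    using assms(1) unfolding local_map_def local_map_with_def semi_act_pt_eq by metis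
  define m' where "m' = iv h \<rhd> m"
  define g where "g = iv (coord \<R> m) \<odot> h \<odot> coord \<R> m'"
  have hG: "h \<in> Gr"
    using h H_closed by blast
  have g: "g \<in> H" "g \<in> Gr"
    unfolding g_def using h coord_H H_closed subgroup_H
    by (simp_all add: subgroup.m_closed subgroup.m_inv_closed)
  have "g \<rhd> o\<^sub>M = iv (coord \<R> m) \<rhd> m"
    using hG by (simp add: g_def act_mult m'_def)
  also have "\<dots> = o\<^sub>M"
    using act_inv_act[of "coord \<R> m" o\<^sub>M] by simp
  finally have stab: "g \<in> stab \<R>" "iv g \<in> stab \<R>"
    using g act_inv_act[of g o\<^sub>M] by (simp_all add: stab_iff)
  let ?l = "(\<lambda>n. x (coord \<R> m' \<rhd> n)) |` N"
  \<comment> \<open>Invariance of \<open>\<delta>\<close> is given only on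
    \<open>restrictions X N\<close>; \<open>?l\<close> belongs there because it comes from a
    translate of \<open>x\<close>.\<close>
  have "pat_act \<R> (iv (coord \<R> m')) x \<in> X"
    using x coord_H subgroup_H by (intro pat_act_X) (simp_all add: subgroup.m_inv_closed)
  then have "(pat_act \<R> (iv (coord \<R> m')) x) |` N \<in> restrictions X N"
    by (auto simp: restrictions_def)
  then have l: "?l \<in> restrictions X N"
    by (simp add: pat_act_def)
  have g_inv: "coord \<R> m' \<odot> iv g = iv h \<odot> coord \<R> m"
    using hG by (simp add: g_def inv_mult_group m_assoc[symmetric])
  have "(\<lambda>n. pat_act \<R> h x (coord \<R> m \<rhd> n)) |` N = pat_act \<R> g ?l"
  proof
    fix n
    \<comment> \<open>Both \<open>g\<close> and \<open>iv g\<close> map \<open>N\<close> into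
      itself, so the two patterns have the same domain.\<close>
    have "iv g \<rhd> n \<in> N \<longleftrightarrow> n \<in> N"
      using N[OF stab(1)] N[OF stab(2)] act_act_inv[OF g(2), of n] by (metis image_subset_iff)
    moreover have "coord \<R> m' \<rhd> iv g \<rhd> n = iv h \<rhd> coord \<R> m \<rhd> n"
      using g_inv g hG by (simp flip: act_mult)
    ultimately show "((\<lambda>n. pat_act \<R> h x (coord \<R> m \<rhd> n)) |` N) n = pat_act \<R> g ?l n"
      by (simp add: pat_act_def restrict_map_def)
  qed
  then show "\<Delta> (pat_act \<R> h x) m = pat_act \<R> h (\<Delta> x) m"
    using \<delta>[OF _ l, of g] g stab x h pat_act_X by (simp add: \<Delta> pat_act_def m'_def)
qed

text \<open>Every ball of radius \<open>\<sigma>\<close> either lies in the larger ball about \<open>t\<close>, where \<open>y' = v\<close> and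
  \<open>y = u\<close>, or misses the smaller one, so that \<open>y' = y\<close> on it.\<close>

lemma splice:
  assumes win: "\<And>c. (\<And>m. \<exists>u\<in>X. \<forall>n\<in>ball m \<sigma>. c n = u n) \<Longrightarrow> c \<in> X"
    and loc: "\<And>u v m. u \<in> X \<Longrightarrow> v \<in> X \<Longrightarrow> (\<And>n. n \<in> ball m \<sigma> \<Longrightarrow> u n = v n) \<Longrightarrow> \<Delta> u m = \<Delta> v m"
    and X: "y \<in> X" "u \<in> X" "v \<in> X" and \<Delta>: "\<Delta> u = \<Delta> v"
    and off: "\<And>n. n \<notin> ball t \<rho> \<Longrightarrow> u n = v n"
    and on: "\<And>n. n \<in> ball t (\<rho> + 2 * \<sigma>) \<Longrightarrow> y n = u n"
  defines "y' \<equiv> \<lambda>n. if n \<in> ball t \<rho> then v n else y n"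
  shows "y' \<in> X" "\<Delta> y' = \<Delta> y"
proof -
  have near: "y' n = v n \<and> y n = u n" if "d t m \<le> \<rho> + \<sigma>" "n \<in> ball m \<sigma>" for m n
  proof -
    have "n \<in> ball t (\<rho> + 2 * \<sigma>)"
      using that dist_triangle[of t n m] by (simp add: in_ball)
    then show ?thesis
      using on off by (simp add: y'_def)
  qed
  have far: "y' n = y n" if "\<not> d t m \<le> \<rho> + \<sigma>" "n \<in> ball m \<sigma>" for m n
    using that dist_triangle[of t m n] dist_sym[of m n] by (simp add: y'_def in_ball)
  show y': "y' \<in> X"
  proof (rule win)
    fix m show "\<exists>w\<in>X. \<forall>n\<in>ball m \<sigma>. y' n = w n"
      using near[of m] far[of m] X by (cases "d t m \<le> \<rho> + \<sigma>") blast+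
  qed
  show "\<Delta> y' = \<Delta> y"
  proof
    fix m show "\<Delta> y' m = \<Delta> y m"
    proof (cases "d t m \<le> \<rho> + \<sigma>")
      case True
      have "\<Delta> y' m = \<Delta> v m" "\<Delta> y m = \<Delta> u m"
        using near[OF True] y' X by (auto intro!: loc)
      then show ?thesis
        using \<Delta> by simp
    qed (use far y' X in \<open>auto intro!: loc\<close>)
  qed
qed

text \<open>Induction on \<open>T\<close>: if \<open>u t\<close> still occurs at \<open>t\<close>,
  splicing in \<open>v t\<close> destroys this occurrence and keeps the image. Separation keeps the
  change away from the balls about the other points.\<close>

lemma exists_avoiding_preimage:
  assumes win: "\<And>c. (\<And>m. \<exists>u\<in>X. \<forall>n\<in>ball m \<sigma>. c n = u n) \<Longrightarrow> c \<in> X"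
    and loc: "\<And>u v m. u \<in> X \<Longrightarrow> v \<in> X \<Longrightarrow> (\<And>n. n \<in> ball m \<sigma> \<Longrightarrow> u n = v n) \<Longrightarrow> \<Delta> u m = \<Delta> v m"
    and "finite T"
    and sep: "\<And>s t. s \<in> T \<Longrightarrow> t \<in> T \<Longrightarrow> s \<noteq> t \<Longrightarrow> 2 * (\<rho> + 2 * \<sigma>) < d s t"
    and uv: "\<And>t. u t \<in> X" "\<And>t. v t \<in> X" "\<And>t. \<Delta> (u t) = \<Delta> (v t)"
    and off: "\<And>t n. n \<notin> ball t \<rho> \<Longrightarrow> u t n = v t n" and "\<And>t. u t \<noteq> v t"
    and y: "y \<in> X"
  shows "\<exists>y'\<in>X. \<Delta> y' = \<Delta> y \<and> (\<forall>t\<in>T. \<exists>n\<in>ball t (\<rho> + 2 * \<sigma>). y' n \<noteq> u t n)"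
  using \<open>finite T\<close> sep
proof (induction T)
  case (insert t T)
  then obtain z where z: "z \<in> X" "\<Delta> z = \<Delta> y" "\<And>s. s \<in> T \<Longrightarrow> \<exists>n\<in>ball s (\<rho> + 2 * \<sigma>). z n \<noteq> u s n"
    by (metis insertI2)
  show ?case
  proof (cases "\<exists>n\<in>ball t (\<rho> + 2 * \<sigma>). z n \<noteq> u t n")
    case False
    define z' where "z' = (\<lambda>n. if n \<in> ball t \<rho> then v t n else z n)"
    have on: "\<And>n. n \<in> ball t (\<rho> + 2 * \<sigma>) \<Longrightarrow> z n = u t n"
      using False by blast
    have z': "z' \<in> X" "\<Delta> z' = \<Delta> z"
      unfolding z'_def
      by (rule splice[OF win loc z(1) uv(1)[of t] uv(2)[of t] uv(3)[of t] off on]; assumption)+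
    have "\<exists>n\<in>ball s (\<rho> + 2 * \<sigma>). z' n \<noteq> u s n" if s: "s \<in> T" for s
    proof -
      have "2 * (\<rho> + 2 * \<sigma>) < d s t"
        using insert.hyps insert.prems s by blast
      then have "n \<notin> ball t \<rho>" if "n \<in> ball s (\<rho> + 2 * \<sigma>)" for n
        using that dist_triangle[of s t n] dist_sym[of n t] by (simp add: in_ball)
      with z(3)[OF s] show ?thesis
        by (auto simp: z'_def)
    qed
    moreover obtain n where n: "u t n \<noteq> v t n"
      using assms(9) by blast
    then have "n \<in> ball t \<rho>"
      using off by blast
    with n have "n \<in> ball t (\<rho> + 2 * \<sigma>)" "z' n \<noteq> u t n"
      by (auto simp: z'_def in_ball)
    ultimately show ?thesis
      using z' z(2) by (metis insert_iff)
  qed (use z in blast)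
qed (use y in blast)

text \<open>Restrictions of members of \<open>X\<close> are allowed, by way of the identity of
  \<open>H\<close>. The strict bound \<open>\<kappa> < d a b\<close> gives distance at least
  \<open>\<kappa> + 1\<close>, also for empty \<open>A\<close> or \<open>B\<close>, where the
  infimum is infinite.\<close>

lemma strongly_irreducible_glue:
  assumes "strongly_irreducible_with \<R> S H Q \<kappa> X"
    and X: "x \<in> X" "y \<in> X" and fin: "finite A" "finite B"
    and far: "\<And>a b. a \<in> A \<Longrightarrow> b \<in> B \<Longrightarrow> \<kappa> < d a b"
  obtains z where "z \<in> X" "\<And>a. a \<in> A \<Longrightarrow> z a = x a" "\<And>b. b \<in> B \<Longrightarrow> z b = y b"
proof -
  have dom: "dom (w |` C) = C" if "w \<in> X" for w C
    using subsetD[OF X_full that] by (auto simp: full_shift_def)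
  have fp: "finite_pattern Q (w |` C)" if "w \<in> X" "finite C" for w C
    using subsetD[OF X_full that(1)] that dom[OF that(1), of C]
    by (auto simp: finite_pattern_def full_shift_def ran_def restrict_map_def split: if_splits)
  have al: "allowed \<R> H X (w |` C)" if "w \<in> X" for w C
  proof -
    have "dom w = UNIV"
      using subsetD[OF X_full that] by (simp add: full_shift_def)
    moreover have "\<one>\<^bsub>grp \<R>\<^esub> \<rhd> m = m" for m
      by (metis UNIV_I id_eq_one restrict_apply')
    ultimately show ?thesis
      using that subgroup.one_closed[OF subgroup_H]
      by (auto simp: allowed_def semi_occurs_iff dom restrict_map_def split: if_splits
          intro!: bexI[of _ w] bexI[of _ "\<one>\<^bsub>grp \<R>\<^esub>"])
  qed
  have "enat (\<kappa> + 1) \<le> set_path_dist \<R> S A B"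
    using far by (auto simp: set_path_dist_def Suc_le_eq intro!: INF_greatest)
  then have "\<exists>z\<in>X. z |` A = x |` A \<and> z |` B = y |` B"
    using assms(1) fp[OF X(1) fin(1)] fp[OF X(2) fin(2)] al[OF X(1), of A] al[OF X(2), of B]
    unfolding strongly_irreducible_with_def by (metis dom X)
  then show ?thesis
    using that by (auto simp: restrict_map_eq_iff)
qed

text \<open>By strong irreducibility, each pattern on \<open>F\<close> can be altered inside \<open>ball t (\<rho> + \<kappa>)\<close> so
  that \<open>u t\<close> occurs at \<open>t\<close>, and at most \<open>K\<close> patterns are altered into the same one. Hence
  forbidding \<open>u t\<close> at one more \<open>t\<close> removes at least the fraction \<open>1 / K\<close> of the patterns.\<close>

lemma card_avoiding_patterns_le:
  assumes si: "strongly_irreducible_with \<R> S H Q \<kappa> X"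
    and "finite F" "finite T"
    and F: "\<And>t. t \<in> T \<Longrightarrow> ball t (\<rho> + \<kappa>) \<subseteq> F"
    and sep: "\<And>s t. s \<in> T \<Longrightarrow> t \<in> T \<Longrightarrow> s \<noteq> t \<Longrightarrow> 2 * (\<rho> + \<kappa>) < d s t"
    and u: "\<And>t. u t \<in> X"
    and K: "card Q ^ card (ball o\<^sub>M (\<rho> + \<kappa>)) \<le> K" "1 \<le> K"
  shows "real (card {p \<in> restrictions X F. \<forall>t\<in>T. \<exists>n\<in>ball t \<rho>. p n \<noteq> u t n})
    \<le> (1 - 1 / real K) ^ card T * real (card (restrictions X F))"
  using \<open>finite T\<close> F sep
proof (induction T)
  case (insert t T)
  define Z where "Z = {p \<in> restrictions X F. \<forall>t\<in>T. \<exists>n\<in>ball t \<rho>. p n \<noteq> u t n}"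
  \<comment> \<open>Passing from \<open>T\<close> to \<open>insert t T\<close> removes exactly
    \<open>W\<close> from \<open>Z\<close>, so \<open>card W\<close> has to be bounded from
    below.\<close>
  define W where "W = {p \<in> Z. \<forall>n\<in>ball t \<rho>. p n = u t n}"
  let ?B = "ball t (\<rho> + \<kappa>)"
  have IH: "real (card Z) \<le> (1 - 1 / real K) ^ card T * real (card (restrictions X F))"
    unfolding Z_def using insert by simp
  have "finite Z"
    unfolding Z_def using finite_restrictions[OF \<open>finite F\<close> finite_Q X_full] by simp
  then have "finite W"
    by (simp add: W_def)
  have tF: "ball t (\<rho> + \<kappa>) \<subseteq> F" "\<And>s. s \<in> T \<Longrightarrow> ball s (\<rho> + \<kappa>) \<subseteq> F"
    using insert.prems by auto
  have "\<exists>q\<in>W. \<forall>n\<in>F - ?B. q n = p n" if p: "p \<in> Z" for p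
  proof -
    obtain x where x: "x \<in> X" "p = x |` F"
      using p by (auto simp: Z_def restrictions_def)
    have "\<kappa> < d a b" if "a \<in> F - ?B" "b \<in> ball t \<rho>" for a b
      using that dist_triangle[of t a b] dist_sym[of a b] by (auto simp: in_ball)
    \<comment> \<open>The pattern \<open>p\<close> outside \<open>?B\<close> is glued to
      \<open>u t\<close> on \<open>ball t \<rho>\<close>; the shell between them provides the gap
      \<open>\<kappa>\<close>.\<close>
    then obtain z where z: "z \<in> X" "\<And>a. a \<in> F - ?B \<Longrightarrow> z a = x a"
      "\<And>b. b \<in> ball t \<rho> \<Longrightarrow> z b = u t b"
      using strongly_irreducible_glue[OF si x(1) u[of t], of "F - ?B" "ball t \<rho>"] \<open>finite F\<close>
      by (metis finite_Diff finite_ball)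
    have "\<exists>n\<in>ball s \<rho>. (z |` F) n \<noteq> u s n" if s: "s \<in> T" for s
    proof -
      obtain n where n: "n \<in> ball s \<rho>" "p n \<noteq> u s n"
        using p s by (auto simp: Z_def)
      have "n \<in> F"
        using n(1) tF(2)[OF s] by (auto simp: in_ball)
      \<comment> \<open>The gluing alters \<open>p\<close> only in \<open>?B\<close>, which misses
        \<open>ball s \<rho>\<close>; so \<open>u s\<close> is still avoided.\<close>
      moreover have "2 * (\<rho> + \<kappa>) < d s t"
        using insert.hyps insert.prems(2) s by blast
      then have "n \<notin> ?B"
        using n(1) dist_triangle[of s t n] dist_sym[of n t] by (auto simp: in_ball)
      ultimately have "(z |` F) n = p n"
        using z(2) x(2) by simp
      with n show ?thesis by metis
    qed
    moreover have "(z |` F) n = u t n" if "n \<in> ball t \<rho>" for n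
    proof -
      have "n \<in> F"
        using that tF(1) by (auto simp: in_ball)
      then show ?thesis
        using z(3)[OF that] by simp
    qed
    ultimately have "z |` F \<in> W"
      using z(1) by (auto simp: W_def Z_def restrictions_def)
    then show ?thesis
      using z(2) x(2) by (intro bexI[of _ "z |` F"]) auto
  qed
  then obtain \<phi> where \<phi>: "\<And>p. p \<in> Z \<Longrightarrow> \<phi> p \<in> W" "\<And>p n. p \<in> Z \<Longrightarrow> n \<in> F - ?B \<Longrightarrow> \<phi> p n = p n"
    by metis
  \<comment> \<open>Patterns altered into the same \<open>q\<close> agree with \<open>q\<close>
    outside \<open>?B\<close>, so at most \<open>K\<close> of them share it.\<close>
  have "card Z \<le> K * card W"
  proof (rule card_le_fibres[where f = \<phi>])
    fix q assume "q \<in> W"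
    have off: "p n = q n" if "p \<in> {p \<in> Z. \<phi> p = q}" "n \<notin> ?B" for p n
    proof (cases "n \<in> F")
      case True
      with that \<phi>(2) show ?thesis by auto
    next
      case False
      with that \<open>q \<in> W\<close> show ?thesis
        by (auto simp: W_def Z_def restrictions_def)
    qed
    have on: "p n \<in> Some ` Q" if "p \<in> {p \<in> Z. \<phi> p = q}" "n \<in> ?B" for p n
      using that tF(1) X_val by (auto simp: Z_def restrictions_def)
    show "finite {p \<in> Z. \<phi> p = q}"
      using \<open>finite Z\<close> by simp
    have "card {p \<in> Z. \<phi> p = q} \<le> card Q ^ card ?B"
      by (rule card_patterns_agreeing_off(2)[OF finite_ball finite_Q, where c = q];
        erule off on; assumption)
    then show "card {p \<in> Z. \<phi> p = q} \<le> K"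
      using K(1) card_ball[of t "\<rho> + \<kappa>"] by simp
  qed (use \<phi> \<open>finite W\<close> in auto)
  then have "real (card Z) \<le> real K * real (card W)"
    by (metis of_nat_le_iff of_nat_mult)
  then have "real (card Z) / real K \<le> real (card W)"
    using K(2) by (simp add: field_simps)
  moreover have "card (Z - W) = card Z - card W" "card W \<le> card Z"
    using \<open>finite Z\<close> \<open>finite W\<close> by (auto simp: W_def intro!: card_Diff_subset card_mono)
  ultimately have "real (card (Z - W)) \<le> (1 - 1 / real K) * real (card Z)"
    by (simp add: of_nat_diff left_diff_distrib)
  also have "\<dots> \<le> (1 - 1 / real K) * ((1 - 1 / real K) ^ card T * real (card (restrictions X F)))"
    using IH K(2) by (intro mult_left_mono) auto
  finally have "real (card (Z - W)) \<le> (1 - 1 / real K) ^ card (insert t T) * real (card (restrictions X F))"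
    using insert.hyps by simp
  moreover have "{p \<in> restrictions X F. \<forall>s\<in>insert t T. \<exists>n\<in>ball s \<rho>. p n \<noteq> u s n} = Z - W"
    by (auto simp: Z_def W_def)
  ultimately show ?case
    by simp
qed simp

section \<open>Counting the image on a finite set\<close>

text \<open>Here \<open>n\<close> is the size of a separated set in the interior of
  \<open>F\<close>, and each of its points costs a factor \<open>1 - 1 / K\<close>. The constants
  are independent of \<open>F\<close>, so the bound applies along the whole net.\<close>

lemma card_image_restrictions_le:
  assumes si: "strongly_irreducible_with \<R> S H Q \<kappa> X"
    and \<Delta>: "local_map \<R> S H Q X Y \<Delta>"
    and "\<not> pre_injective X \<Delta>"
  obtains r \<tau> B K :: nat where "1 \<le> B" "2 \<le> K"
    and "\<And>F. finite F \<Longrightarrow> \<exists>n. card (inner \<R> S r F) \<le> B * n \<and>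
      real (card (restrictions (\<Delta> ` X) F)) \<le>
        real (card Q) ^ card (bdry \<R> S \<tau> F) * (1 - 1 / real K) ^ n * real (card (restrictions X F))"
proof -
  obtain x x' where x: "x \<in> X" "x' \<in> X" "\<Delta> x = \<Delta> x'" "x \<noteq> x'"
    and fin: "finite {m. x m \<noteq> x' m}"
    using assms(3) unfolding pre_injective_def by blast
  define \<rho> where "\<rho> = Max (d o\<^sub>M ` {m. x m \<noteq> x' m})"
  have \<rho>: "m \<in> ball o\<^sub>M \<rho>" if "x m \<noteq> x' m" for m
    using that fin by (auto simp: in_ball \<rho>_def intro!: Max_ge)
  obtain \<sigma>\<^sub>1 where win: "\<And>c. (\<And>m. \<exists>u\<in>X. \<forall>n\<in>ball m \<sigma>\<^sub>1. c n = u n) \<Longrightarrow> c \<in> X"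
    using window by blast
  obtain \<tau> where loc: "\<And>u v m. u \<in> X \<Longrightarrow> v \<in> X \<Longrightarrow> (\<And>n. n \<in> ball m \<tau> \<Longrightarrow> u n = v n) \<Longrightarrow> \<Delta> u m = \<Delta> v m"
    using local_map_window[OF \<Delta>] by blast
  \<comment> \<open>Splicing uses a single radius both for membership in \<open>X\<close> and for
    evaluating \<open>\<Delta>\<close>.\<close>
  define \<sigma> where "\<sigma> = max \<sigma>\<^sub>1 \<tau>"
  have sub: "ball m \<sigma>\<^sub>1 \<subseteq> ball m \<sigma>" "ball m \<tau> \<subseteq> ball m \<sigma>" for m
    by (auto simp: in_ball \<sigma>_def)
  have win': "c \<in> X" if "\<And>m. \<exists>u\<in>X. \<forall>n\<in>ball m \<sigma>. c n = u n" for c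
    using that sub(1) by (intro win) blast
  have loc': "\<Delta> u m = \<Delta> v m" if "u \<in> X" "v \<in> X" "\<And>n. n \<in> ball m \<sigma> \<Longrightarrow> u n = v n" for u v m
    using that sub(2) by (intro loc) auto
  \<comment> \<open>Translation by \<open>coord \<R> t\<close>, an element of \<open>H\<close>,
    centres a copy of the pair at \<open>t\<close>, inside \<open>X\<close> and with equal
    images.\<close>
  define u where "u t = pat_act \<R> (coord \<R> t) x" for t
  define v where "v t = pat_act \<R> (coord \<R> t) x'" for t
  have uv: "u t \<in> X" "v t \<in> X" "\<Delta> (u t) = \<Delta> (v t)" for t
    unfolding u_def v_def using x coord_H
    by (simp_all add: pat_act_X local_map_equivariant[OF \<Delta>])
  have off: "u t n = v t n" if "n \<notin> ball t \<rho>" for t n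
  proof (rule ccontr)
    assume "u t n \<noteq> v t n"
    then have "iv (coord \<R> t) \<rhd> n \<in> ball o\<^sub>M \<rho>"
      by (intro \<rho>) (simp add: u_def v_def pat_act_def)
    then have "n \<in> ball t \<rho>"
      using dist_act[of "coord \<R> t" o\<^sub>M "iv (coord \<R> t) \<rhd> n"] by (simp add: in_ball)
    with that show False by simp
  qed
  have ne: "u t \<noteq> v t" for t
  proof
    assume eq: "u t = v t"
    have "x m = x' m" for m
      using fun_cong[OF eq, of "coord \<R> t \<rhd> m"] by (simp add: u_def v_def pat_act_def)
    with x(4) show False by auto
  qed
  \<comment> \<open>Splicing needs \<open>u t\<close> to occur on radius
    \<open>\<rho> + 2 * \<sigma>\<close>; gluing needs a further gap
    \<open>\<kappa>\<close>.\<close>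
  define r where "r = (\<rho> + 2 * \<sigma>) + \<kappa>"
  define B where "B = card (ball o\<^sub>M (2 * r))"
  \<comment> \<open>The power bounds the fibres of the alteration; the summand 2 keeps
    \<open>1 - 1 / K\<close> positive, as its logarithm is taken later.\<close>
  define K where "K = card Q ^ card (ball o\<^sub>M r) + 2"
  have "o\<^sub>M \<in> ball o\<^sub>M (2 * r)"
    by (simp add: in_ball)
  then have B: "1 \<le> B"
    unfolding B_def by (metis One_nat_def Suc_leI card_gt_0_iff empty_iff finite_ball)
  have "\<exists>n. card (inner \<R> S r F) \<le> B * n \<and>
      real (card (restrictions (\<Delta> ` X) F)) \<le>
        real (card Q) ^ card (bdry \<R> S \<tau> F) * (1 - 1 / real K) ^ n * real (card (restrictions X F))"
    if F: "finite F" for F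
  proof -
    obtain T where T: "T \<subseteq> inner \<R> S r F" "card (inner \<R> S r F) \<le> B * card T"
      and sep: "\<And>s t. s \<in> T \<Longrightarrow> t \<in> T \<Longrightarrow> s \<noteq> t \<Longrightarrow> 2 * r < d s t"
      using separated_subset_exists[OF F, of r] unfolding B_def by metis
    have finT: "finite T"
      using T(1) F by (auto simp: inner_def intro: finite_subset)
    have TF: "ball t r \<subseteq> F" if "t \<in> T" for t
      using that T(1) by (auto simp: inner_def)
    define Z where "Z = {z \<in> X. \<forall>t\<in>T. \<exists>n\<in>ball t (\<rho> + 2 * \<sigma>). z n \<noteq> u t n}"
    have Z: "Z \<subseteq> full_shift Q"
      using X_full by (auto simp: Z_def)
    have "\<exists>z\<in>Z. \<Delta> z = \<Delta> y" if y: "y \<in> X" for y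
    proof -
      have sep': "2 * (\<rho> + 2 * \<sigma>) < d s t" if "s \<in> T" "t \<in> T" "s \<noteq> t" for s t
        using sep[OF that] by (simp add: r_def)
      have "\<exists>z\<in>X. \<Delta> z = \<Delta> y \<and> (\<forall>t\<in>T. \<exists>n\<in>ball t (\<rho> + 2 * \<sigma>). z n \<noteq> u t n)"
        by (rule exists_avoiding_preimage[OF win' loc' finT sep' uv off ne y])
      then show ?thesis
        by (auto simp: Z_def)
    qed
    then have "\<Delta> ` X \<subseteq> \<Delta> ` Z"
      by (metis image_eqI image_subsetI)
    then have \<Delta>Z: "\<Delta> ` X = \<Delta> ` Z"
      by (auto simp: Z_def)
    \<comment> \<open>The image on \<open>F\<close> reads configurations on this neighbourhood. Its
      cells outside \<open>F\<close> lie in the boundary and cost at most a factor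
      \<open>card Q\<close> each.\<close>
    let ?O = "outer \<R> S \<tau> F"
    have finO: "finite ?O"
      using F by (rule finite_outer)
    have "card (restrictions (\<Delta> ` X) F) = card ((\<lambda>z. \<Delta> z |` F) ` Z)"
      by (simp add: \<Delta>Z restrictions_def image_image)
    also have "\<dots> \<le> card ((\<lambda>z. z |` ?O) ` Z)"
    proof (rule card_image_le_if_determined)
      show "finite ((\<lambda>z. z |` ?O) ` Z)"
        using finite_restrictions[OF finO finite_Q Z] by (simp add: restrictions_def)
      fix z z' assume z: "z \<in> Z" "z' \<in> Z" "z |` ?O = z' |` ?O"
      have "\<Delta> z m = \<Delta> z' m" if "m \<in> F" for m
        using z ball_subset_outer[OF that, of \<tau>]
        by (intro loc) (auto simp: Z_def restrict_map_eq_iff)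
      then show "\<Delta> z |` F = \<Delta> z' |` F"
        by (simp add: restrict_map_eq_iff)
    qed
    also have "\<dots> = card (restrictions Z (F \<union> (?O - F)))"
      using subset_outer[of F \<tau>] by (simp add: restrictions_def Un_absorb1)
    also have "\<dots> \<le> card Q ^ card (?O - F) * card (restrictions Z F)"
      using F finO finite_Q Z by (intro card_restrictions_Un) auto
    also have "\<dots> \<le> card Q ^ card (bdry \<R> S \<tau> F) * card (restrictions Z F)"
    proof -
      have "x o\<^sub>M \<in> Some ` Q"
        using x(1) by (rule X_val)
      then have "1 \<le> card Q"
        using finite_Q by (metis One_nat_def Suc_leI card_gt_0_iff empty_iff image_empty)
      moreover have "card (?O - F) \<le> card (bdry \<R> S \<tau> F)"
        using finite_bdry[OF F] by (intro card_mono) (auto simp: bdry_def inner_def)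
      ultimately show ?thesis
        by (intro mult_right_mono power_increasing) auto
    qed
    finally have 1: "real (card (restrictions (\<Delta> ` X) F))
        \<le> real (card Q) ^ card (bdry \<R> S \<tau> F) * real (card (restrictions Z F))"
      by (metis of_nat_le_iff of_nat_mult of_nat_power)
    let ?A = "{p \<in> restrictions X F. \<forall>t\<in>T. \<exists>n\<in>ball t (\<rho> + 2 * \<sigma>). p n \<noteq> u t n}"
    have "restrictions Z F \<subseteq> ?A"
    proof
      fix p assume "p \<in> restrictions Z F"
      then obtain z where z: "z \<in> Z" "p = z |` F"
        by (auto simp: restrictions_def)
      have "\<exists>n\<in>ball t (\<rho> + 2 * \<sigma>). p n \<noteq> u t n" if t: "t \<in> T" for t
      proof -
        obtain n where n: "n \<in> ball t (\<rho> + 2 * \<sigma>)" "z n \<noteq> u t n"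
          using z(1) t by (auto simp: Z_def)
        then have "n \<in> F"
          using TF[OF t] by (auto simp: in_ball r_def)
        with n z(2) show ?thesis
          by (intro bexI[of _ n]) simp_all
      qed
      then show "p \<in> ?A"
        using z by (auto simp: Z_def restrictions_def)
    qed
    moreover have "finite ?A"
      using finite_restrictions[OF F finite_Q X_full] by simp
    ultimately have "real (card (restrictions Z F)) \<le> real (card ?A)"
      by (simp add: card_mono)
    also have "\<dots> \<le> (1 - 1 / real K) ^ card T * real (card (restrictions X F))"
      using TF sep uv(1) by (intro card_avoiding_patterns_le[OF si F finT]) (auto simp: r_def K_def)
    finally have "real (card (restrictions (\<Delta> ` X) F)) \<le> real (card Q) ^ card (bdry \<R> S \<tau> F) *
        ((1 - 1 / real K) ^ card T * real (card (restrictions X F)))"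
      using 1 by (meson mult_left_mono order_trans zero_le_power of_nat_0_le_iff)
    with T(2) show ?thesis
      by (auto simp: mult.assoc)
  qed
  then show ?thesis
    using that[of B K r \<tau>] B by (simp add: K_def)
qed

end

section \<open>The entropy gap\<close>

text \<open>Directedness makes the tails a filter base, and reflexivity makes each of them
  non-empty.\<close>

lemma tails_neq_bot:
  assumes "directed_set I rel" shows "tails I rel \<noteq> bot"
proof -
  have "(INF i\<in>I. principal {j \<in> I. rel i j}) = bot \<longleftrightarrow> (\<exists>i\<in>I. principal {j \<in> I. rel i j} = bot)"
  proof (rule INF_filter_bot_base)
    fix i j assume ij: "i \<in> I" "j \<in> I"
    then obtain k where k: "k \<in> I" "rel i k" "rel j k"
      using assms by (auto simp: directed_set_def)
    have "rel i l" "rel j l" if "l \<in> I" "rel k l" for l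
      using assms ij k that unfolding directed_set_def by (meson transp_onD)+
    with k(1) show "\<exists>k\<in>I. principal {l \<in> I. rel k l} \<le> inf (principal {l \<in> I. rel i l}) (principal {l \<in> I. rel j l})"
      by (intro bexI[of _ k]) auto
  qed
  moreover have "i \<in> {j \<in> I. rel i j}" if "i \<in> I" for i
    using assms that by (simp add: directed_set_def reflp_on_def)
  ultimately show ?thesis
    unfolding tails_def by (metis (no_types, lifting) empty_iff principal_eq_bot_iff)
qed

text \<open>The filter lives on the whole index type, whereas the net is controlled only on
  \<open>I\<close>.\<close>

lemma eventually_tails_mem:
  assumes "directed_set I rel" shows "eventually (\<lambda>i. i \<in> I) (tails I rel)"
proof -
  obtain i where "i \<in> I"
    using assms by (auto simp: directed_set_def)
  then show ?thesis
    unfolding tails_def by (rule eventually_INF1) (simp add: eventually_principal)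
qed

section \<open>Logarithms and the strict inequality\<close>

text \<open>Read \<open>f\<close> as the size of a finite set, \<open>j\<close> as that of its
  interior, \<open>e\<close> and \<open>e'\<close> as those of two boundaries. Then \<open>n\<close>
  is at least \<open>f / (2 * B)\<close>, so \<open>n * ln \<theta>\<close> is at most
  \<open>f * ln \<theta> / (2 * B)\<close>; the boundary factor cancels less than half of this
  gain.\<close>

lemma log_ext_gap:
  fixes a b q e e' j n f B :: nat and \<theta> :: real
  assumes a: "real a \<le> real q ^ e * \<theta> ^ n * real b"
    and pos: "0 < \<theta>" "\<theta> < 1" "1 \<le> b" "1 \<le> q" "1 \<le> f" "1 \<le> B"
    and f: "f \<le> j + e'" "j \<le> B * n"
    and e: "real e' / real f < 1 / 2" "real e / real f * ln (real q) < - ln \<theta> / (4 * real B)"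
  shows "log_ext a / ereal (real f) \<le> log_ext b / ereal (real f) + ereal (ln \<theta> / (4 * real B))"
proof (cases "a = 0")
  \<comment> \<open>Here \<open>log_ext a\<close> is minus infinity and stays so after division by
    the positive \<open>f\<close>.\<close>
  case True
  with pos show ?thesis by (simp add: log_ext_def)
next
  case False
  have "ln (real a) \<le> ln (real q ^ e * \<theta> ^ n * real b)"
    using a False by simp
  also have "\<dots> = real e * ln (real q) + real n * ln \<theta> + ln (real b)"
    using pos by (simp add: ln_mult ln_realpow)
  also have "real e * ln (real q) \<le> - ln \<theta> / (4 * real B) * real f"
    using e(2) pos by (simp add: field_simps)
  also have "real n * ln \<theta> \<le> real f / (2 * real B) * ln \<theta>"
  proof (rule mult_right_mono_neg)
    have "real e' \<le> real f / 2"
      using e(1) pos by (simp add: field_simps)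
    moreover have "real f \<le> real j + real e'" "real j \<le> real B * real n"
      using f by (simp_all flip: of_nat_add of_nat_mult)
    ultimately have "real f / 2 \<le> real B * real n"
      by linarith
    then show "real f / (2 * real B) \<le> real n"
      using pos by (simp add: field_simps)
  qed (use pos in simp)
  finally have "ln (real a) \<le> ln (real b) + ln \<theta> / (4 * real B) * real f"
    by (simp add: field_simps)
  then have "ln (real a) / real f \<le> ln (real b) / real f + ln \<theta> / (4 * real B)"
    using pos by (simp add: field_simps)
  with False pos show ?thesis
    by (simp add: log_ext_def)
qed

theorem theorem4p5:
  fixes \<R> :: "('g, 'm) cell_space"
    and S :: "'g set set"
    and H :: "'g set"
    and Q :: "'q set"
    and I :: "'i set"
    and rel :: "'i \<Rightarrow> 'i \<Rightarrow> bool"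
    and F :: "'i \<Rightarrow> 'm set"
    and X Y :: "('m \<rightharpoonup> 'q) set"
    and \<Delta> :: "('m \<rightharpoonup> 'q) \<Rightarrow> ('m \<rightharpoonup> 'q)"
  assumes "is_cell_space \<R>"
    and "finite (stab \<R>)"
    and "finite S" and "sym_right_generating \<R> S"
    and "subgroup H (grp \<R>)" and "\<forall>m. coord \<R> m \<in> H"
    and "finite Q"
    and "right_amenable \<R>"
    and "right_folner_net \<R> S I rel F"
    and "infinite (UNIV :: 'm set)"
    and "subshift_finite_type \<R> H Q X"
    and "strongly_irreducible \<R> S H Q X"
    and "subshift \<R> H Q Y"
    and "local_map \<R> S H Q X Y \<Delta>"
    and "\<not> pre_injective X \<Delta>"
  shows "entropy I rel F (\<Delta> ` X) < entropy I rel F X"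
proof -
  interpret shift_of_finite_type \<R> S H Q X
    using assms
    by (intro shift_of_finite_type.intro shift_of_finite_type_axioms.intro generated_cell_space.intro)
      auto
  obtain \<kappa> where "strongly_irreducible_with \<R> S H Q \<kappa> X"
    using assms by (auto simp: strongly_irreducible_def)
  then obtain r \<tau> B K :: nat where BK: "1 \<le> B" "2 \<le> K"
    and bound: "\<And>F. finite F \<Longrightarrow> \<exists>n. card (inner \<R> S r F) \<le> B * n \<and>
      real (card (restrictions (\<Delta> ` X) F)) \<le>
        real (card Q) ^ card (bdry \<R> S \<tau> F) * (1 - 1 / real K) ^ n * real (card (restrictions X F))"
    using card_image_restrictions_le[OF _ assms(14,15)] by metis
  \<comment> \<open>Failure of pre-injectivity supplies a member of \<open>X\<close>; so
    \<open>Q\<close> is non-empty and no pattern count for \<open>X\<close> along the net is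
    0.\<close>
  obtain x where x: "x \<in> X"
    using assms(15) by (auto simp: pre_injective_def)
  have "x (orig \<R>) \<in> Some ` Q"
    using x by (rule X_val)
  then have Q: "1 \<le> card Q"
    using finite_Q by (metis One_nat_def Suc_leI card_gt_0_iff empty_iff image_empty)
  define \<theta> where "\<theta> = 1 - 1 / real K"
  have \<theta>: "0 < \<theta>" "\<theta> < 1"
    using BK by (simp_all add: \<theta>_def)
  define c where "c = ln \<theta> / (4 * real B)"
  have c: "c < 0"
    using \<theta> BK by (simp add: c_def divide_neg_pos)
  define h where "h V i = log_ext (card (restrictions V (F i))) / ereal (real (card (F i)))" for V :: "('m \<rightharpoonup> 'q) set" and i
  have dir: "directed_set I rel"
    and F: "\<And>i. i \<in> I \<Longrightarrow> finite (F i)" "\<And>i. i \<in> I \<Longrightarrow> F i \<noteq> {}"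
    and folner: "\<And>\<rho>. ((\<lambda>i. real (card (bdry \<R> S \<rho> (F i))) / real (card (F i))) \<longlongrightarrow> 0) (tails I rel)"
    using assms(9) by (auto simp: right_folner_net_def)
  note nbot = tails_neq_bot[OF dir]
  have X_pos: "1 \<le> card (restrictions X (F i))" if "i \<in> I" for i
  proof -
    have "x |` F i \<in> restrictions X (F i)"
      using x by (simp add: restrictions_def)
    then show ?thesis
      using finite_restrictions[OF F(1)[OF that] finite_Q X_full]
      by (metis One_nat_def Suc_leI card_gt_0_iff empty_iff)
  qed
  have F_pos: "1 \<le> card (F i)" if "i \<in> I" for i
    using F[OF that] by (metis One_nat_def Suc_leI card_gt_0_iff)
  \<comment> \<open>These bounds will make the entropy of \<open>X\<close> a real number.\<close>
  have h_X: "0 \<le> h X i \<and> h X i \<le> ereal (ln (real (card Q)))" if i: "i \<in> I" for i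
  proof -
    let ?b = "card (restrictions X (F i))"
    have "real ?b \<le> real (card Q) ^ card (F i)"
      using card_restrictions_le[OF F(1)[OF i] finite_Q X_full] by (metis of_nat_le_iff of_nat_power)
    then have "ln (real ?b) \<le> ln (real (card Q) ^ card (F i))"
      using X_pos[OF i] by (intro ln_mono) auto
    then have "ln (real ?b) \<le> real (card (F i)) * ln (real (card Q))"
      using Q by (simp add: ln_realpow)
    then have "ln (real ?b) / real (card (F i)) \<le> ln (real (card Q))"
      using F_pos[OF i] by (simp add: field_simps)
    then show ?thesis
      using X_pos[OF i] F_pos[OF i] by (simp add: h_def log_ext_def)
  qed
  \<comment> \<open>The boundary vanishes at two radii: \<open>r\<close> for the loss in passing to
    the interior, \<open>\<tau>\<close> for the cells read outside the set.\<close>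
  have "eventually (\<lambda>i. real (card (bdry \<R> S r (F i))) / real (card (F i)) < 1 / 2) (tails I rel)"
    using folner by (rule order_tendstoD) simp
  moreover have "((\<lambda>i. real (card (bdry \<R> S \<tau> (F i))) / real (card (F i)) * ln (real (card Q))) \<longlongrightarrow> 0) (tails I rel)"
    using folner by (rule tendsto_mult_left_zero)
  then have "eventually (\<lambda>i. real (card (bdry \<R> S \<tau> (F i))) / real (card (F i)) * ln (real (card Q)) < - c) (tails I rel)"
    by (rule order_tendstoD) (use c in simp)
  ultimately have "eventually (\<lambda>i. h (\<Delta> ` X) i \<le> h X i + ereal c) (tails I rel)"
    using eventually_tails_mem[OF dir]
  proof eventually_elim
    case (elim i)
    obtain n where n: "card (inner \<R> S r (F i)) \<le> B * n"
      "real (card (restrictions (\<Delta> ` X) (F i))) \<le>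
        real (card Q) ^ card (bdry \<R> S \<tau> (F i)) * \<theta> ^ n * real (card (restrictions X (F i)))"
      using bound[OF F(1)[OF elim(3)]] unfolding \<theta>_def by blast
    show ?case
      unfolding h_def c_def
      by (rule log_ext_gap[OF n(2) \<theta> X_pos[OF elim(3)] Q F_pos[OF elim(3)] BK(1)
            card_le_inner_bdry[OF F(1)[OF elim(3)]] n(1) elim(1)])
        (use elim(2) in \<open>simp add: c_def\<close>)
  qed
  then have "Limsup (tails I rel) (h (\<Delta> ` X)) \<le> Limsup (tails I rel) (\<lambda>i. h X i + ereal c)"
    by (rule Limsup_mono)
  also have "\<dots> = Limsup (tails I rel) (h X) + ereal c"
    using nbot by (rule Limsup_add_ereal_right) simp
  also have "\<dots> < Limsup (tails I rel) (h X)"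
  proof -
    have "0 \<le> Limsup (tails I rel) (h X)"
      using nbot h_X eventually_tails_mem[OF dir] by (intro le_Limsup) (auto elim: eventually_mono)
    moreover have "Limsup (tails I rel) (h X) \<le> ereal (ln (real (card Q)))"
      using h_X eventually_tails_mem[OF dir] by (intro Limsup_bounded) (auto elim: eventually_mono)
    \<comment> \<open>Finiteness makes the inequality strict: adding \<open>c\<close> to an infinite
      value would leave it unchanged.\<close>
    ultimately obtain l where "Limsup (tails I rel) (h X) = ereal l"
      by (cases "Limsup (tails I rel) (h X)") auto
    with c show ?thesis by simp
  qed
  finally show ?thesis
    by (simp add: entropy_def h_def[abs_def])
qed

end
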